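(* Let $g\in W^{1,2}(\mathbb{S}^1,\mathbb{R}^2)$ with $I(g)=\int_{\mathbb{S}^1}W(\nabla u^g)\,d\theta<\infty$, where $W(F)=\frac12|F|^2+h(\det F)$, $h$ is as in the context, $f(t)=th'(t)-h(t)$ and $d=\det\nabla u^g$. Suppose $g$ satisfies, for all smooth $\varphi:\mathbb{S}^1\to\mathbb{R}$, $$\int_{\mathbb{S}^1}\Big(f(d)+\tfrac12|g'|^2-\tfrac12|g|^2\Big)\varphi'\,d\theta=0,$$ $$\int_{\mathbb{S}^1}\Big(|g'|^2+|g|^2+2d\,h'(d)\Big)\varphi+(g'\cdot g)\,\varphi'\,d\theta=0$$ (the integrands being integrable). Then $$\operatorname{ess\,inf}\{d(\theta):\theta\in\mathbb{S}^1\}=0$$ if and only if there is $\theta_0$ such that $g(\theta_0)=0$. In particular, $g$ is Lipschitz if and only if $g$ is never zero.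
   Context: $h:\mathbb{R}\to(0,+\infty]$ satisfies: $h(t)=+\infty$ if $t\le 0$; $h(t)\to\infty$ as $t\to0+$; $h$ is positive, $C^2$ and strongly convex on $(0,\infty)$ (there is $\mu>0$ with $h''\ge\mu$). Functions on $\mathbb{S}^1$ are written as $2\pi$-periodic functions of the polar angle $\theta$, with $'=d/d\theta$; $g$ is identified with its continuous representative. $u^g(x)=|x|\,g(x/|x|)$; with $e_R=(\cos\theta,\sin\theta)$, $e_\theta=(-\sin\theta,\cos\theta)$, $\nabla u^g=g\otimes e_R+g'\otimes e_\theta$ depends only on $\theta$, and $d=Jg\cdot g'$ with $J=\begin{pmatrix}0&-1\\1&0\end{pmatrix}$. *)

theory Defs
  imports "HOL-Analysis.Analysis" "HOL-Probability.Essential_Supremum"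
begin

subsection \<open>The volumetric energy\<close>

text \<open>Real-valued version of \<^term>\<open>h\<close>; meaningful only where \<^term>\<open>h\<close> is finite, i.e. on the
  positive half-line.\<close>

definition fin :: "(real \<Rightarrow> ennreal) \<Rightarrow> real \<Rightarrow> real" where
  "fin h t = enn2real (h t)"

definition C2_on :: "real set \<Rightarrow> (real \<Rightarrow> real) \<Rightarrow> bool" where
  "C2_on S p \<longleftrightarrow>
     (\<forall>t\<in>S. p field_differentiable at t) \<and>
     (\<forall>t\<in>S. deriv p field_differentiable at t) \<and>
     continuous_on S (deriv (deriv p))"

definition admissible :: "(real \<Rightarrow> ennreal) \<Rightarrow> bool" where
  "admissible h \<longleftrightarrow>
     (\<forall>t. 0 < h t) \<and>
     (\<forall>t\<le>0. h t = \<infinity>) \<and>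
     (\<forall>t>0. h t < \<infinity>) \<and>
     (h \<longlongrightarrow> \<infinity>) (at_right 0) \<and>
     C2_on {0<..} (fin h) \<and>
     (\<exists>\<mu>>0. \<forall>t>0. \<mu> \<le> deriv (deriv (fin h)) t)"

definition f_of :: "(real \<Rightarrow> ennreal) \<Rightarrow> real \<Rightarrow> real" where
  "f_of h t = t * deriv (fin h) t - fin h t"

text \<open>The norm of \<^typ>\<open>real^2^2\<close> is the Frobenius norm.\<close>

definition W :: "(real \<Rightarrow> ennreal) \<Rightarrow> real^2^2 \<Rightarrow> ennreal" where
  "W h F = ennreal (1/2 * (norm F)\<^sup>2) + h (det F)"


subsection \<open>Functions on the circle\<close>

text \<open>Functions on the circle are \<^term>\<open>2 * pi\<close>-periodic functions of the polar angle; integrals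
  over the circle are integrals over one period.\<close>

definition periodic :: "(real \<Rightarrow> 'a) \<Rightarrow> bool" where
  "periodic p \<longleftrightarrow> (\<forall>\<theta>. p (\<theta> + 2 * pi) = p \<theta>)"

abbreviation circle :: "real measure" where
  "circle \<equiv> lebesgue_on {0..2*pi}"

definition smooth_circle :: "(real \<Rightarrow> real) \<Rightarrow> bool" where
  "smooth_circle \<phi> \<longleftrightarrow>
     periodic \<phi> \<and> (\<forall>n \<theta>. (deriv ^^ n) \<phi> field_differentiable at \<theta>)"

definition L2_circle :: "(real \<Rightarrow> 'a::euclidean_space) \<Rightarrow> bool" where
  "L2_circle p \<longleftrightarrow>
     periodic p \<and> p \<in> borel_measurable circle \<and> integrable circle (\<lambda>\<theta>. (norm (p \<theta>))\<^sup>2)"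

definition weak_deriv_circle :: "(real \<Rightarrow> 'a::euclidean_space) \<Rightarrow> (real \<Rightarrow> 'a) \<Rightarrow> bool" where
  "weak_deriv_circle g g' \<longleftrightarrow>
     (\<forall>\<phi>. smooth_circle \<phi> \<longrightarrow>
        (LINT \<theta>|circle. deriv \<phi> \<theta> *\<^sub>R g \<theta>) = - (LINT \<theta>|circle. \<phi> \<theta> *\<^sub>R g' \<theta>))"

text \<open>\<open>W12_circle g g'\<close>: \<^term>\<open>g\<close> is in $W^{1,2}$ of the circle, with weak derivative
  \<^term>\<open>g'\<close>.\<close>

definition W12_circle :: "(real \<Rightarrow> 'a::euclidean_space) \<Rightarrow> (real \<Rightarrow> 'a) \<Rightarrow> bool" where
  "W12_circle g g' \<longleftrightarrow> L2_circle g \<and> L2_circle g' \<and> weak_deriv_circle g g'"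

definition ess_inf :: "'a measure \<Rightarrow> ('a \<Rightarrow> real) \<Rightarrow> ereal" where
  "ess_inf M p = - esssup M (\<lambda>x. - ereal (p x))"


subsection \<open>The one-homogeneous extension and its gradient\<close>

definition e_R :: "real \<Rightarrow> real^2" where
  "e_R \<theta> = vector [cos \<theta>, sin \<theta>]"

definition e_\<theta> :: "real \<Rightarrow> real^2" where
  "e_\<theta> \<theta> = vector [- sin \<theta>, cos \<theta>]"

definition tensor :: "real^2 \<Rightarrow> real^2 \<Rightarrow> real^2^2"  (infixr "\<otimes>" 75) where
  "a \<otimes> b = (\<chi> i j. a $ i * b $ j)"

text \<open>\<open>homog g\<close> is the map $u^g(x) = |x| g(x/|x|)$, the point $x/|x|$ being represented by its
  polar angle. Its gradient at a point of polar angle \<^term>\<open>\<theta>\<close> is \<open>grad_u g g' \<theta>\<close>, whatever the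
  radius: see \<open>has_derivative_homog\<close> below.\<close>

definition homog :: "(real \<Rightarrow> real^2) \<Rightarrow> real^2 \<Rightarrow> real^2" where
  "homog g x = norm x *\<^sub>R g (Arg (Complex (x $ 1) (x $ 2)))"

definition grad_u :: "(real \<Rightarrow> real^2) \<Rightarrow> (real \<Rightarrow> real^2) \<Rightarrow> real \<Rightarrow> real^2^2" where
  "grad_u g g' \<theta> = g \<theta> \<otimes> e_R \<theta> + g' \<theta> \<otimes> e_\<theta> \<theta>"

definition jac :: "(real \<Rightarrow> real^2) \<Rightarrow> (real \<Rightarrow> real^2) \<Rightarrow> real \<Rightarrow> real" where
  "jac g g' \<theta> = det (grad_u g g' \<theta>)"

definition energy ::
    "(real \<Rightarrow> ennreal) \<Rightarrow> (real \<Rightarrow> real^2) \<Rightarrow> (real \<Rightarrow> real^2) \<Rightarrow> ennreal" where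
  "energy h g g' = (\<integral>\<^sup>+\<theta>. W h (grad_u g g' \<theta>) \<partial>circle)"

definition J :: "real^2^2" where
  "J = vector [vector [0, -1], vector [1, 0]]"

lemma jac_eq: "jac g g' \<theta> = (J *v g \<theta>) \<bullet> g' \<theta>"
proof -
  have "(a * c - a' * s) * (b * s + b' * c) - (a * s + a' * c) * (b * c - b' * s) = a * b' - a' * b"
    if "s\<^sup>2 + c\<^sup>2 = 1" for a a' b b' s c :: real
    using that by algebra
  from this[OF sin_cos_squared_add, of "g \<theta> $ 1" \<theta> "g' \<theta> $ 1" "g \<theta> $ 2" "g' \<theta> $ 2"]
  show ?thesis
    by (simp add: jac_def det_2 grad_u_def tensor_def e_R_def e_\<theta>_def J_def
        matrix_vector_mult_def inner_vec_def sum_2 mult.commute)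
qed

lemma norm_grad_u: "(norm (grad_u g g' \<theta>))\<^sup>2 = (norm (g \<theta>))\<^sup>2 + (norm (g' \<theta>))\<^sup>2"
proof -
  have "(a * c - a' * s)\<^sup>2 + (a * s + a' * c)\<^sup>2 = a\<^sup>2 + a'\<^sup>2"
    if "s\<^sup>2 + c\<^sup>2 = 1" for a a' s c :: real
    using that by algebra
  note eq = this[OF sin_cos_squared_add[of \<theta>]]
  show ?thesis
    using eq[of "g \<theta> $ 1" "g' \<theta> $ 1"] eq[of "g \<theta> $ 2" "g' \<theta> $ 2"]
    unfolding power2_norm_eq_inner inner_vec_def
    by (simp add: sum_2 grad_u_def tensor_def e_R_def e_\<theta>_def power2_eq_square)
qed

lemma has_derivative_homog:
  fixes g :: "real \<Rightarrow> real^2"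
  assumes "periodic g" and g': "(g has_vector_derivative g' \<theta>) (at \<theta>)" and r: "0 < r"
  shows "(homog g has_derivative (\<lambda>v. grad_u g g' \<theta> *v v)) (at (r *\<^sub>R e_R \<theta>))"
proof -
  define z :: "real^2 \<Rightarrow> complex" where "z x = Complex (x $ 1) (x $ 2) * cis (- \<theta>)" for x
  have nat_per: "g (b + 2 * of_nat k * pi) = g b" for b k
  proof (induction k)
    case (Suc k)
    have "g (b + 2 * of_nat k * pi + 2 * pi) = g (b + 2 * of_nat k * pi)"
      using assms(1) by (simp add: periodic_def)
    with Suc show ?case by (simp add: algebra_simps)
  qed simp
  have per: "g (a + 2 * of_int n * pi) = g a" for a n
  proof (cases "n \<ge> 0")
    case True
    then show ?thesis using nat_per[of a "nat n"] by simp
  next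
    case False
    then show ?thesis using nat_per[of "a + 2 * of_int n * pi" "nat (- n)"] by simp
  qed
  have homog_eq: "homog g x = norm x *\<^sub>R g (\<theta> + Im (Ln (z x)))" for x
  proof (cases "x = 0")
    case False
    define w where "w = Complex (x $ 1) (x $ 2)"
    have w: "w \<noteq> 0"
      using False by (auto simp: w_def complex_eq_iff vec_eq_iff forall_2)
    have zw: "z x = w * cis (- \<theta>)"
      by (simp add: z_def w_def)
    have z: "z x \<noteq> 0"
      using w by (simp add: zw)
    have "exp (Ln (z x)) = exp (Ln w + of_real (- \<theta>) * \<i>)"
      using w z by (simp add: exp_add exp_diff exp_minus zw cis_conv_exp mult.commute divide_inverse)
    then obtain n :: int where n: "Ln (z x) = Ln w + of_real (- \<theta>) * \<i> + (of_int (2 * n) * pi) * \<i>"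
      unfolding exp_eq by auto
    have "\<theta> + Im (Ln (z x)) = Arg w + 2 * of_int n * pi"
      using n w by (simp add: Arg_eq_Im_Ln)
    then show ?thesis
      by (simp add: homog_def w_def per)
  qed (simp add: homog_def)
  have e_R: "norm (e_R \<theta>) = 1"
    by (simp add: e_R_def norm_eq_1 inner_vec_def sum_2 flip: power2_eq_square)
  have zp: "z (r *\<^sub>R e_R \<theta>) = of_real r"
    using sin_cos_squared_add[of \<theta>]
    by (simp add: z_def e_R_def complex_eq_iff power2_eq_square algebra_simps flip: distrib_left)
  have z_eq: "z = (\<lambda>x. (of_real (x $ 1) + \<i> * of_real (x $ 2)) * cis (- \<theta>))"
    by (simp add: z_def fun_eq_iff complex_eq_iff)
  have "bounded_linear z"
    unfolding z_eq
    by (intro bounded_linear_mult_const bounded_linear_add bounded_linear_const_mult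
        bounded_linear_compose[OF bounded_linear_of_real] bounded_linear_vec_nth)
  then have dz: "(z has_derivative z) (at (r *\<^sub>R e_R \<theta>))"
    by (rule bounded_linear_imp_has_derivative)
  have "(Ln has_derivative (*) (1 / of_real r)) (at (z (r *\<^sub>R e_R \<theta>)))"
    using has_field_derivative_Ln[of "of_real r"] r
    by (simp add: zp has_field_derivative_def inverse_eq_divide)
  from has_derivative_add[OF has_derivative_const[of \<theta>]
      has_derivative_Im[OF has_derivative_compose[OF dz this]]]
  have "((\<lambda>x. \<theta> + Im (Ln (z x))) has_derivative (\<lambda>v. 0 + Im (1 / of_real r * z v)))
      (at (r *\<^sub>R e_R \<theta>))" .
  moreover have "0 + Im (1 / of_real r * z v) = (v \<bullet> e_\<theta> \<theta>) / r" for v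
    using r by (simp add: z_def e_\<theta>_def inner_vec_def sum_2 field_simps)
  ultimately have dLn:
    "((\<lambda>x. \<theta> + Im (Ln (z x))) has_derivative (\<lambda>v. (v \<bullet> e_\<theta> \<theta>) / r)) (at (r *\<^sub>R e_R \<theta>))"
    by (simp only:)
  have "Im (Ln (z (r *\<^sub>R e_R \<theta>))) = 0"
    using r by (simp add: zp)
  then have "(g has_derivative (\<lambda>t. t *\<^sub>R g' \<theta>)) (at (\<theta> + Im (Ln (z (r *\<^sub>R e_R \<theta>)))))"
    using g' by (simp add: has_vector_derivative_def)
  from has_derivative_compose[OF dLn this]
  have dg: "((\<lambda>x. g (\<theta> + Im (Ln (z x)))) has_derivative (\<lambda>v. ((v \<bullet> e_\<theta> \<theta>) / r) *\<^sub>R g' \<theta>))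
      (at (r *\<^sub>R e_R \<theta>))" .
  have "r *\<^sub>R e_R \<theta> \<noteq> 0"
    using e_R r by auto
  from has_derivative_norm[OF this]
  have dnorm: "(norm has_derivative (\<lambda>v. v \<bullet> e_R \<theta>)) (at (r *\<^sub>R e_R \<theta>))"
    using e_R r by (simp add: sgn_div_norm)
  have "((\<lambda>x. norm x *\<^sub>R g (\<theta> + Im (Ln (z x)))) has_derivative
      (\<lambda>v. r *\<^sub>R (((v \<bullet> e_\<theta> \<theta>) / r) *\<^sub>R g' \<theta>) + (v \<bullet> e_R \<theta>) *\<^sub>R g \<theta>)) (at (r *\<^sub>R e_R \<theta>))"
    using has_derivative_scaleR[OF dnorm dg] e_R r zp by simp
  moreover have "r *\<^sub>R (((v \<bullet> e_\<theta> \<theta>) / r) *\<^sub>R g' \<theta>) + (v \<bullet> e_R \<theta>) *\<^sub>R g \<theta> = grad_u g g' \<theta> *v v"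
    for v
  proof -
    have "r *\<^sub>R (((v \<bullet> e_\<theta> \<theta>) / r) *\<^sub>R g' \<theta>) = (v \<bullet> e_\<theta> \<theta>) *\<^sub>R g' \<theta>"
      using r by simp
    then show ?thesis
      by (simp add: vec_eq_iff grad_u_def tensor_def matrix_vector_mult_def sum_2
          inner_vec_def algebra_simps)
  qed
  ultimately show ?thesis
    by (simp add: homog_eq[abs_def] fun_eq_iff)
qed

end

theory Submission
  imports Defs
begin

text \<open>
  The first equation says that \<open>f(d) + |g'|^2/2 - |g|^2/2\<close> is a constant, so an upper bound on
  \<open>|g'|\<close> is a lower bound on \<open>f(d)\<close>. Since \<open>f\<close> is increasing and \<open>f(t)\<close> tends to
  \<open>-\<infinity>\<close> as \<open>t\<close> decreases to 0, \<open>g\<close> is Lipschitz if and only if \<open>d\<close> is essentially bounded below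
  by a positive constant. In that case \<open>d \<le> |g| |g'|\<close> keeps \<open>|g|\<close> away from zero. Conversely, by
  the second equation \<open>g' \<bullet> g\<close> is absolutely continuous, hence bounded; if \<open>|g|\<close> is bounded below,
  the identity \<open>|g|^2 |g'|^2 = (g' \<bullet> g)^2 + d^2\<close> bounds \<open>|g'|\<close> where \<open>d \<le> 1\<close>, so that \<open>d\<close>
  cannot be small.
\<close>

section \<open>Test functions\<close>

text \<open>A class of smooth functions that is closed under differentiation and contains approximations
  of the indicator functions of arcs.\<close>

inductive tanh_trig :: "(real \<Rightarrow> real) \<Rightarrow> bool" where
  const: "tanh_trig (\<lambda>x. c)"
| sin: "tanh_trig (\<lambda>x. sin (x + c))"
| add: "tanh_trig p \<Longrightarrow> tanh_trig q \<Longrightarrow> tanh_trig (\<lambda>x. p x + q x)"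
| mult: "tanh_trig p \<Longrightarrow> tanh_trig q \<Longrightarrow> tanh_trig (\<lambda>x. p x * q x)"
| tanh: "tanh_trig p \<Longrightarrow> tanh_trig (\<lambda>x. tanh (p x))"

text \<open>The arbitrary phase in \<open>sin\<close> makes cosine unnecessary as a separate
  generator: differentiating shifts the phase by \<open>pi/2\<close>. Since tanh' = 1 - tanh^2, the
  derivative of a \<open>tanh\<close> is a polynomial in members of the class.\<close>

lemma tanh_trig_has_derivative:
  "tanh_trig p \<Longrightarrow> \<exists>q. tanh_trig q \<and> (\<forall>x. (p has_field_derivative q x) (at x))"
proof (induction rule: tanh_trig.induct)
  case (const c)
  then show ?case by (intro exI[of _ "\<lambda>x. 0"]) (auto intro: tanh_trig.const)
next
  case (sin c)
  have "((\<lambda>x. sin (x + c)) has_field_derivative sin (x + (c + pi/2))) (at x)" for x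
    by (auto intro!: derivative_eq_intros simp: sin_add cos_add algebra_simps)
  then show ?case using tanh_trig.sin by blast
next
  case (add p q)
  then obtain p' q' where d: "tanh_trig p'" "tanh_trig q'" "\<And>x. (p has_field_derivative p' x) (at x)"
    "\<And>x. (q has_field_derivative q' x) (at x)" by auto
  show ?case
    by (intro exI[of _ "\<lambda>x. p' x + q' x"] conjI allI tanh_trig.intros DERIV_add d)
next
  case (mult p q)
  then obtain p' q' where d: "tanh_trig p'" "tanh_trig q'" "\<And>x. (p has_field_derivative p' x) (at x)"
    "\<And>x. (q has_field_derivative q' x) (at x)" by auto
  show ?case
    by (intro exI[of _ "\<lambda>x. p' x * q x + q' x * p x"] conjI allI tanh_trig.intros DERIV_mult d
        mult.hyps)
next
  case (tanh p)
  then obtain p' where p': "tanh_trig p'" "\<And>x. (p has_field_derivative p' x) (at x)" by auto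
  \<comment> \<open>The factor 1 - tanh^2 is spelled with \<open>+\<close>, \<open>(- 1) *\<close>
    and a product, so that it matches the generators of \<open>tanh_trig\<close> literally.\<close>
  have d: "((\<lambda>x. tanh (p x)) has_field_derivative (1 + (- 1) * (tanh (p x) * tanh (p x))) * p' x)
      (at x)" for x
    using has_field_derivative_tanh[OF _ p'(2)[of x]] by (simp add: power2_eq_square)
  show ?case
    by (intro exI[of _ "\<lambda>x. (1 + (- 1) * (tanh (p x) * tanh (p x))) * p' x"] conjI allI
        tanh_trig.intros tanh.hyps p' d)
qed

lemma tanh_trig_deriv_funpow: "tanh_trig p \<Longrightarrow> tanh_trig ((deriv ^^ n) p)"
proof (induction n)
  case (Suc n)
  obtain q where q: "tanh_trig q" "\<And>x. ((deriv ^^ n) p has_field_derivative q x) (at x)"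
    using tanh_trig_has_derivative[OF Suc.IH[OF Suc.prems]] by auto
  have "deriv ((deriv ^^ n) p) = q"
    by (intro ext DERIV_imp_deriv q)
  with q(1) show ?case by simp
qed simp

lemma tanh_trig_isCont:
  assumes "tanh_trig p"
  shows "isCont p x"
proof -
  obtain q where "\<And>x. (p has_field_derivative q x) (at x)"
    using tanh_trig_has_derivative[OF assms] by auto
  then show ?thesis by (rule DERIV_isCont)
qed

text \<open>Vanishing mean is exactly what makes the primitive periodic. The primitive itself may
  leave the class \<open>tanh_trig\<close>, but from the first derivative on all its derivatives are
  those of \<open>\<psi>\<close>, which stay in the class.\<close>

lemma smooth_primitive:
  assumes "tanh_trig \<psi>" "periodic \<psi>" "integral {0..2*pi} \<psi> = 0"
  obtains \<Phi> where "smooth_circle \<Phi>" "deriv \<Phi> = \<psi>" "\<And>t. 0 \<le> t \<Longrightarrow> \<Phi> t = integral {0..t} \<psi>"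
proof -
  have "isCont \<psi> x" for x
    using assms(1) by (rule tanh_trig_isCont)
  then obtain F where F: "\<And>x. (F has_field_derivative \<psi> x) (at x)"
    using einterval_antiderivative[of "-\<infinity>" \<infinity> \<psi>]
    by (auto simp: has_real_derivative_iff_has_vector_derivative)
  define \<Phi> where "\<Phi> x = F x - F 0" for x
  have \<Phi>: "(\<Phi> has_field_derivative \<psi> x) (at x)" for x
    unfolding \<Phi>_def by (auto intro!: derivative_eq_intros F)
  have int: "\<Phi> t = integral {0..t} \<psi>" if "0 \<le> t" for t
  proof -
    have "(\<psi> has_integral \<Phi> t - \<Phi> 0) {0..t}"
      using that \<Phi> by (intro fundamental_theorem_of_calculus)
        (auto simp: has_real_derivative_iff_has_vector_derivative[symmetric]
          intro: has_field_derivative_at_within)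
    then show ?thesis by (simp add: \<Phi>_def integral_unique)
  qed
  have d: "deriv \<Phi> = \<psi>"
    using \<Phi> by (auto intro: DERIV_imp_deriv)
  \<comment> \<open>Periodicity of \<open>\<psi>\<close> makes the increment of
    \<open>\<Phi>\<close> over a period independent of \<open>x\<close>; at \<open>x = 0\<close> it
    is the integral of \<open>\<psi>\<close> over the period, which is 0.\<close>
  have "((\<lambda>x. \<Phi> (x + 2*pi) - \<Phi> x) has_field_derivative 0) (at x)" for x
  proof -
    have "((\<lambda>x. \<Phi> (x + 2*pi)) has_field_derivative \<psi> x) (at x)"
      using \<Phi>[of "x + 2*pi"] assms(2) by (simp add: DERIV_shift periodic_def)
    from DERIV_diff[OF this \<Phi>[of x]] show ?thesis by simp
  qed
  then have "\<Phi> (x + 2*pi) - \<Phi> x = \<Phi> (0 + 2*pi) - \<Phi> 0" for x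
    using DERIV_isconst_all by (metis (no_types, lifting))
  then have "periodic \<Phi>"
    using int[of "2*pi"] int[of 0] assms(3) by (auto simp: periodic_def \<Phi>_def)
  moreover have "(deriv ^^ n) \<Phi> field_differentiable at x" for n x
  proof (cases n)
    case 0
    then show ?thesis using \<Phi> by (auto simp: field_differentiable_def)
  next
    case (Suc m)
    have "(deriv ^^ n) \<Phi> = (deriv ^^ m) \<psi>"
      by (simp add: Suc funpow_Suc_right d del: funpow.simps)
    moreover have "tanh_trig ((deriv ^^ m) \<psi>)"
      using assms(1) by (rule tanh_trig_deriv_funpow)
    ultimately show ?thesis
      using tanh_trig_has_derivative by (auto simp: field_differentiable_def)
  qed
  ultimately have "smooth_circle \<Phi>"
    by (simp add: smooth_circle_def)
  with d int show ?thesis using that by blast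
qed

section \<open>Smooth approximation of indicators of arcs\<close>

lemma cos_gt_cos_iff_arc:
  fixes t m r :: real
  assumes "0 \<le> r" "\<bar>t - m\<bar> \<le> 2*pi - r"  "r \<le> pi" "\<bar>t - m\<bar> \<noteq> r" "\<bar>t - m\<bar> \<noteq> 2*pi - r"
  shows "\<bar>t - m\<bar> < r \<Longrightarrow> cos (t - m) > cos r" "\<bar>t - m\<bar> > r \<Longrightarrow> cos (t - m) < cos r"
proof -
  have c: "cos (t - m) = cos \<bar>t - m\<bar>" by simp
  show "\<bar>t - m\<bar> < r \<Longrightarrow> cos (t - m) > cos r"
    unfolding c using assms by (intro cos_monotone_0_pi) auto
  assume gt: "\<bar>t - m\<bar> > r"
  show "cos (t - m) < cos r"
  proof (cases "\<bar>t - m\<bar> \<le> pi")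
    case True
    then show ?thesis unfolding c using assms gt by (intro cos_monotone_0_pi) auto
  next
    case False
    \<comment> \<open>Beyond pi the cosine increases again, so the distance is reflected at pi. A
      distance below \<open>2*pi - r\<close> is reflected to one above \<open>r\<close>, where
      monotonicity on [0, pi] applies; at \<open>2*pi - r\<close> the next copy of the arc would
      begin.\<close>
    have "cos (2*pi - \<bar>t - m\<bar>) < cos r"
      using assms gt False by (intro cos_monotone_0_pi) auto
    then show ?thesis by (simp add: cos_diff)
  qed
qed

lemma tanh_mult_nat_tendsto:
  fixes y :: real
  shows "0 < y \<Longrightarrow> (\<lambda>k. tanh (real k * y)) \<longlonglongrightarrow> 1"
    "y < 0 \<Longrightarrow> (\<lambda>k. tanh (real k * y)) \<longlonglongrightarrow> -1"
proof -
  assume "0 < y"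
  then have "filterlim (\<lambda>k. real k * y) at_top sequentially"
    by (intro filterlim_at_top_mult_tendsto_pos[OF tendsto_const] filterlim_real_sequentially)
  then show "(\<lambda>k. tanh (real k * y)) \<longlonglongrightarrow> 1"
    by (rule filterlim_compose[OF tanh_real_at_top])
next
  assume "y < 0"
  then have "filterlim (\<lambda>k. y * real k) at_bot sequentially"
    by (intro filterlim_tendsto_neg_mult_at_bot[OF tendsto_const] filterlim_real_sequentially)
  then show "(\<lambda>k. tanh (real k * y)) \<longlonglongrightarrow> -1"
    by (subst mult.commute) (rule filterlim_compose[OF tanh_real_at_bot])
qed

lemma smooth_circle_tanh_trig:
  assumes "tanh_trig p" "periodic p"
  shows "smooth_circle p"
  using assms tanh_trig_has_derivative[OF tanh_trig_deriv_funpow[OF assms(1)]]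
  by (force simp: smooth_circle_def field_differentiable_def)

lemma AE_lebesgue_on_notin:
  assumes "negligible N" "S \<in> sets lebesgue"
  shows "AE x in lebesgue_on S. x \<notin> N"
proof -
  have "N \<in> null_sets lebesgue"
    using assms(1) by (simp add: negligible_iff_null_sets)
  then have "AE x in lebesgue. x \<notin> N" by (rule AE_not_in)
  then show ?thesis
    using assms(2) by (auto simp: AE_restrict_space_iff)
qed

text \<open>The function cos(t - m) - cos r is positive on the arc with midpoint \<open>m\<close>
  and half-length \<open>r\<close>, and negative off its closure. Multiplied by \<open>k\<close> and
  passed through \<open>tanh\<close>, it tends to the sign, which is then rescaled to 0 and 1. At
  \<open>a\<close> and \<open>b\<close> it vanishes; 0 and \<open>2*pi\<close> are excluded as well
  because they may be copies of \<open>b\<close> or \<open>a\<close> modulo the period.\<close>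

lemma arc_mollifiers:
  fixes a b :: real
  assumes "0 \<le> a" "a < b" "b \<le> 2*pi"
  obtains S :: "nat \<Rightarrow> real \<Rightarrow> real" where
    "\<And>k. tanh_trig (S k)" "\<And>k. periodic (S k)" "\<And>k t. \<bar>S k t\<bar> \<le> 1"
    "\<And>t. t \<in> {0..2*pi} - {0, a, b, 2*pi} \<Longrightarrow> (\<lambda>k. S k t) \<longlonglongrightarrow> indicator {a<..<b} t"
proof -
  define m where "m = (a + b) / 2"
  define r where "r = (b - a) / 2"
  define S where "S k t = 1/2 + 1/2 * tanh (real k * (sin (t + (pi/2 - m)) + - cos r))" for k t
  have sin_eq: "sin (t + (pi/2 - m)) = cos (t - m)" for t
    by (simp add: sin_add cos_diff sin_diff)
  have "tanh_trig (S k)" for k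
    unfolding S_def by (intro tanh_trig.intros)
  moreover have "periodic (S k)" for k
  proof -
    have "sin (t + 2*pi + (pi/2 - m)) = sin (t + (pi/2 - m))" for t
      using sin_periodic[of "t + (pi/2 - m)"] by (simp add: algebra_simps)
    then show ?thesis by (simp add: periodic_def S_def)
  qed
  moreover have "\<bar>S k t\<bar> \<le> 1" for k t
    using tanh_real_bounds[of "real k * (sin (t + (pi/2 - m)) + - cos r)"]
    by (simp add: S_def abs_if)
  moreover have "(\<lambda>k. S k t) \<longlonglongrightarrow> indicator {a<..<b} t"
    if t: "t \<in> {0..2*pi} - {0, a, b, 2*pi}" for t
  proof -
    have r: "0 \<le> r" "\<bar>t - m\<bar> \<le> 2*pi - r" "r \<le> pi" "\<bar>t - m\<bar> \<noteq> r" "\<bar>t - m\<bar> \<noteq> 2*pi - r"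
      using assms t by (auto simp: m_def r_def abs_if field_simps)
    have "(\<lambda>k. tanh (real k * (sin (t + (pi/2 - m)) + - cos r)))
        \<longlonglongrightarrow> (if \<bar>t - m\<bar> < r then 1 else - 1)"
      using cos_gt_cos_iff_arc[OF r] r(4) unfolding sin_eq
      by (auto intro!: tanh_mult_nat_tendsto)
    then have "(\<lambda>k. S k t) \<longlonglongrightarrow> 1/2 + 1/2 * (if \<bar>t - m\<bar> < r then 1 else - 1)"
      unfolding S_def by (intro tendsto_intros)
    moreover have "\<bar>t - m\<bar> < r \<longleftrightarrow> a < t \<and> t < b"
      by (auto simp: m_def r_def abs_if field_simps)
    ultimately show ?thesis by (auto simp: indicator_def split: if_splits)
  qed
  ultimately show ?thesis using that by blast
qed

text \<open>By dominated convergence the primitives of the mollifiers tend to the primitive of the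
  indicator, i.e. the length of the part of the arc below \<open>t\<close>: a ramp rising from 0 to
  \<open>b - a\<close>.\<close>

lemma tendsto_integral_arc_mollifiers:
  fixes a b :: real
  assumes ab: "0 \<le> a" "a < b" "b \<le> 2*pi"
    and S: "\<And>k. continuous_on UNIV (S k)" "\<And>k t. \<bar>S k t\<bar> \<le> (1::real)"
    "\<And>t. t \<in> {0..2*pi} - {0, a, b, 2*pi} \<Longrightarrow> (\<lambda>k. S k t) \<longlonglongrightarrow> indicator {a<..<b} t"
    and t: "0 \<le> t" "t \<le> 2*pi"
  shows "(\<lambda>k. integral {0..t} (S k)) \<longlonglongrightarrow> max 0 (min t b - a)"
proof -
  have m: "S k \<in> borel_measurable (lebesgue_on {0..t})" for k
    by (intro continuous_imp_measurable_on_sets_lebesgue continuous_on_subset[OF S(1)]) auto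
  have fin: "finite_measure (lebesgue_on {0..t})"
    using t by (intro finite_measureI) (auto simp: emeasure_restrict_space)
  have c: "integrable (lebesgue_on {0..t}) (\<lambda>x. 1::real)"
    using finite_measure.integrable_const[OF fin] .
  have i: "integrable (lebesgue_on {0..t}) (S k)" for k
    by (rule Bochner_Integration.integrable_bound[OF c m]) (use S(2) in auto)
  have "(\<lambda>k. LINT x|lebesgue_on {0..t}. S k x)
      \<longlonglongrightarrow> (LINT x|lebesgue_on {0..t}. indicator {a<..<b} x)"
  proof (rule integral_dominated_convergence[OF _ m c])
    show "(\<lambda>x. indicator {a<..<b} x :: real) \<in> borel_measurable (lebesgue_on {0..t})"
      by (intro measurable_restrict_space1 borel_measurable_indicator) simp
    have "AE x in lebesgue_on {0..t}. x \<notin> {0, a, b, 2*pi}"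
      by (intro AE_lebesgue_on_notin) auto
    moreover have "AE x in lebesgue_on {0..t}. x \<in> {0..t}"
      by (rule AE_I2) simp
    ultimately show "AE x in lebesgue_on {0..t}. (\<lambda>k. S k x) \<longlonglongrightarrow> indicator {a<..<b} x"
      by eventually_elim (use S(3) t in auto)
    show "AE x in lebesgue_on {0..t}. norm (S k x) \<le> 1" for k
      using S(2) by (intro AE_I2) auto
  qed
  moreover have "(LINT x|lebesgue_on {0..t}. S k x) = integral {0..t} (S k)" for k
    using i by (intro lebesgue_integral_eq_integral) auto
  moreover have "(LINT x|lebesgue_on {0..t}. indicator {a<..<b} x) = max 0 (min t b - a)"
  proof -
    have "(LINT x|lebesgue_on {0..t}. indicator {a<..<b} x)
        = measure lebesgue ({a<..<b} \<inter> {0..t})"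
      by (simp add: measure_restrict_space)
    moreover have "{a<..<b} \<inter> {0..t} =
        (if t \<le> a then {} else if t < b then {a<..t} else {a<..<b})"
      using ab t by auto
    ultimately show ?thesis using ab by auto
  qed
  ultimately show ?thesis by simp
qed

section \<open>Weak derivatives on the circle\<close>

text \<open>The weak formulation tested with a primitive of the indicator function of an arc minus its
  mean.\<close>

lemma weak_derivative_trapezoid:
  fixes u v :: "real \<Rightarrow> 'a::euclidean_space"
  assumes u: "integrable circle u" and v: "integrable circle v"
    and weak: "\<And>\<phi>. smooth_circle \<phi> \<Longrightarrow>
      (LINT \<theta>|circle. deriv \<phi> \<theta> *\<^sub>R u \<theta>) = - (LINT \<theta>|circle. \<phi> \<theta> *\<^sub>R v \<theta>)"
    and ab: "0 \<le> a" "a < b" "b \<le> 2*pi"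
  shows "(LINT t|circle. (indicator {a<..<b} t - (b - a) / (2*pi)) *\<^sub>R u t)
    = - (LINT t|circle. (max 0 (min t b - a) - t * ((b - a) / (2*pi))) *\<^sub>R v t)"
proof -
  obtain S :: "nat \<Rightarrow> real \<Rightarrow> real" where S: "\<And>k. tanh_trig (S k)" "\<And>k. periodic (S k)"
    "\<And>k t. \<bar>S k t\<bar> \<le> 1"
    "\<And>t. t \<in> {0..2*pi} - {0, a, b, 2*pi} \<Longrightarrow> (\<lambda>k. S k t) \<longlonglongrightarrow> indicator {a<..<b} t"
    using arc_mollifiers[OF ab] by metis
  have cont: "continuous_on A (S k)" for k A
    using tanh_trig_isCont[OF S(1)] by (simp add: continuous_at_imp_continuous_on)
  have int: "S k integrable_on {0..t}" for k t
    using cont by (rule integrable_continuous_real)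
  note lim = tendsto_integral_arc_mollifiers[OF ab cont S(3,4)]
  \<comment> \<open>The mean of \<open>S k\<close>. Subtracting it gives the function
    \<open>\<psi> k\<close> with integral 0, whose primitive is an admissible test function by
    \<open>smooth_primitive\<close>.\<close>
  define m where "m k = integral {0..2*pi} (S k) / (2*pi)" for k
  have m_lim: "m \<longlonglongrightarrow> (b - a) / (2*pi)"
  proof -
    have "max 0 (min (2*pi) b - a) = b - a" using ab by auto
    then show ?thesis
      unfolding m_def using lim[of "2*pi"] by (intro tendsto_divide) auto
  qed
  have bound: "\<bar>integral {0..t} (S k)\<bar> \<le> 1 * t" if "0 \<le> t" for k t
    using has_integral_bound_real[OF _ finite.emptyI integrable_integral[OF int], of 1 t k] S(3) that
    by auto
  have m_bound: "\<bar>m k\<bar> \<le> 1" for k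
    using bound[of "2*pi" k] by (simp add: m_def)
  define \<psi> where "\<psi> k t = S k t + - m k" for k t
  have "\<exists>\<Phi>. smooth_circle \<Phi> \<and> deriv \<Phi> = \<psi> k \<and> (\<forall>t\<ge>0. \<Phi> t = integral {0..t} (\<psi> k))" for k
  proof -
    have "tanh_trig (\<psi> k)"
      unfolding \<psi>_def by (intro tanh_trig.intros S(1))
    moreover have "periodic (\<psi> k)"
      using S(2) by (simp add: \<psi>_def periodic_def)
    moreover have "integral {0..2*pi} (\<psi> k) = integral {0..2*pi} (S k) - 2*pi * m k"
      unfolding \<psi>_def using int by (simp add: integral_diff integrable_const_ivl)
    then have "integral {0..2*pi} (\<psi> k) = 0"
      by (simp add: m_def)
    ultimately show ?thesis
      by (metis smooth_primitive)
  qed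
  then obtain \<Phi> where \<Phi>: "\<And>k. smooth_circle (\<Phi> k)" "\<And>k. deriv (\<Phi> k) = \<psi> k"
    "\<And>k t. 0 \<le> t \<Longrightarrow> \<Phi> k t = integral {0..t} (\<psi> k)" by metis
  have \<Phi>_eq: "\<Phi> k t = integral {0..t} (S k) - t * m k" if "0 \<le> t" for k t
    unfolding \<Phi>(3)[OF that] \<psi>_def using int that by (simp add: integral_diff integrable_const_ivl)
  \<comment> \<open>The integral of \<open>S k\<close> and the term \<open>t * m k\<close>
    contribute at most \<open>2*pi\<close> each. The bound is uniform in \<open>k\<close>, as
    dominated convergence requires.\<close>
  have \<Phi>_bound: "\<bar>\<Phi> k t\<bar> \<le> 4*pi" if "0 \<le> t" "t \<le> 2*pi" for k t
  proof -
    have "\<bar>t * m k\<bar> \<le> 2*pi * 1"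
      using m_bound that unfolding abs_mult by (intro mult_mono) auto
    then show ?thesis
      using bound[of t k] that \<Phi>_eq[of t k] by auto
  qed
  have \<Phi>_meas: "\<Phi> k \<in> borel_measurable circle" for k
  proof (rule continuous_imp_measurable_on_sets_lebesgue)
    have "\<Phi> k field_differentiable at t" for t
      using \<Phi>(1)[of k] funpow_0[of deriv "\<Phi> k"] unfolding smooth_circle_def by metis
    then show "continuous_on {0..2*pi} (\<Phi> k)"
      by (simp add: continuous_at_imp_continuous_on field_differentiable_imp_continuous_at)
  qed simp
  have \<psi>_meas: "\<psi> k \<in> borel_measurable circle" for k
    unfolding \<psi>_def
    by (intro continuous_imp_measurable_on_sets_lebesgue continuous_intros cont) simp
  have u_meas: "u \<in> borel_measurable circle" and v_meas: "v \<in> borel_measurable circle"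
    using u v by simp_all
  have sp: "x \<in> space circle \<longleftrightarrow> 0 \<le> x \<and> x \<le> 2*pi" for x :: real
    by (auto)
  \<comment> \<open>The two sides of the weak formulation for \<open>\<Phi> k\<close> are passed to
    the limit separately, with dominating functions that are constant multiples of
    \<open>norm (u t)\<close> and \<open>norm (v t)\<close>.\<close>
  have "(\<lambda>k. LINT t|circle. \<psi> k t *\<^sub>R u t)
      \<longlonglongrightarrow> (LINT t|circle. (indicator {a<..<b} t - (b - a) / (2*pi)) *\<^sub>R u t)"
  proof (rule integral_dominated_convergence[where w = "\<lambda>t. 2 * norm (u t)"])
    show "(\<lambda>t. (indicator {a<..<b} t - (b - a) / (2*pi)) *\<^sub>R u t) \<in> borel_measurable circle"
      by (intro borel_measurable_scaleR u_meas borel_measurable_diff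
          measurable_restrict_space1[OF borel_measurable_indicator] borel_measurable_const) simp
    show "(\<lambda>t. \<psi> k t *\<^sub>R u t) \<in> borel_measurable circle" for k
      by (intro borel_measurable_scaleR u_meas \<psi>_meas)
    show "integrable circle (\<lambda>t. 2 * norm (u t))" using u by simp
    have "AE x in circle. x \<notin> {0, a, b, 2*pi}"
      by (intro AE_lebesgue_on_notin) auto
    moreover have "AE x in circle. x \<in> {0..2*pi}"
      by (rule AE_I2) simp
    ultimately show "AE t in circle. (\<lambda>k. \<psi> k t *\<^sub>R u t)
        \<longlonglongrightarrow> (indicator {a<..<b} t - (b - a) / (2*pi)) *\<^sub>R u t"
    proof eventually_elim
      case (elim t)
      then have "(\<lambda>k. S k t) \<longlonglongrightarrow> indicator {a<..<b} t" by (intro S(4)) auto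
      then show ?case
        unfolding \<psi>_def add_uminus_conv_diff by (intro tendsto_intros m_lim)
    qed
    have "\<bar>\<psi> k t\<bar> \<le> 2" for k t
      using S(3)[of k t] m_bound[of k] by (simp add: \<psi>_def)
    then show "AE t in circle. norm (\<psi> k t *\<^sub>R u t) \<le> 2 * norm (u t)" for k
      by (intro AE_I2) (auto intro!: mult_right_mono)
  qed
  moreover have "(\<lambda>k. LINT t|circle. \<Phi> k t *\<^sub>R v t)
      \<longlonglongrightarrow> (LINT t|circle. (max 0 (min t b - a) - t * ((b - a) / (2*pi))) *\<^sub>R v t)"
  proof (rule integral_dominated_convergence[where w = "\<lambda>t. (4*pi) * norm (v t)"])
    show "(\<lambda>t. (max 0 (min t b - a) - t * ((b - a) / (2*pi))) *\<^sub>R v t) \<in> borel_measurable circle"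
      by (intro borel_measurable_scaleR v_meas continuous_imp_measurable_on_sets_lebesgue
          continuous_intros) simp
    show "(\<lambda>t. \<Phi> k t *\<^sub>R v t) \<in> borel_measurable circle" for k
      by (intro borel_measurable_scaleR v_meas \<Phi>_meas)
    show "integrable circle (\<lambda>t. (4*pi) * norm (v t))" using v by simp
    show "AE t in circle. (\<lambda>k. \<Phi> k t *\<^sub>R v t)
        \<longlonglongrightarrow> (max 0 (min t b - a) - t * ((b - a) / (2*pi))) *\<^sub>R v t"
    proof (rule AE_I2)
      fix t assume "t \<in> space circle"
      then have t: "0 \<le> t" "t \<le> 2*pi" by (auto simp: sp)
      show "(\<lambda>k. \<Phi> k t *\<^sub>R v t)
        \<longlonglongrightarrow> (max 0 (min t b - a) - t * ((b - a) / (2*pi))) *\<^sub>R v t"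
        unfolding \<Phi>_eq[OF t(1)] by (intro tendsto_intros m_lim lim t)
    qed
    show "AE t in circle. norm (\<Phi> k t *\<^sub>R v t) \<le> (4*pi) * norm (v t)" for k
      using \<Phi>_bound by (intro AE_I2) (auto simp: sp intro!: mult_right_mono)
  qed
  then have "(\<lambda>k. - (LINT t|circle. \<Phi> k t *\<^sub>R v t))
      \<longlonglongrightarrow> - (LINT t|circle. (max 0 (min t b - a) - t * ((b - a) / (2*pi))) *\<^sub>R v t)"
    by (rule tendsto_minus)
  moreover have "(LINT t|circle. \<psi> k t *\<^sub>R u t) = - (LINT t|circle. \<Phi> k t *\<^sub>R v t)" for k
    using weak[OF \<Phi>(1)[of k]] by (simp add: \<Phi>(2))
  ultimately show ?thesis
    using LIMSEQ_unique by simp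
qed

section \<open>Recovering a function from its weak derivative\<close>

lemma integrable_bounded_scaleR:
  fixes u :: "real \<Rightarrow> 'a::euclidean_space"
  assumes "integrable M u" "w \<in> borel_measurable M" "\<And>x. x \<in> space M \<Longrightarrow> \<bar>w x\<bar> \<le> B"
  shows "integrable M (\<lambda>x. w x *\<^sub>R u x)"
proof (rule Bochner_Integration.integrable_bound)
  show "integrable M (\<lambda>x. B *\<^sub>R u x)" using assms(1) by simp
  show "(\<lambda>x. w x *\<^sub>R u x) \<in> borel_measurable M"
    using assms by (intro borel_measurable_scaleR) auto
  show "AE x in M. norm (w x *\<^sub>R u x) \<le> norm (B *\<^sub>R u x)"
    using assms(3) by (intro AE_I2) (force intro!: mult_right_mono)
qed

lemma integrable_indicator_scaleR:
  fixes w :: "real \<Rightarrow> 'a::euclidean_space"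
  assumes "integrable (lebesgue_on S) w" "A \<in> sets lebesgue"
  shows "integrable (lebesgue_on S) (\<lambda>t. indicator A t *\<^sub>R w t)"
proof (rule integrable_bounded_scaleR[OF assms(1)])
  show "indicator A \<in> borel_measurable (lebesgue_on S)"
    using assms(2) by (intro measurable_restrict_space1 borel_measurable_indicator)
  show "\<bar>indicator A x :: real\<bar> \<le> 1" for x :: real
    by (simp add: indicator_def)
qed

lemma LINT_lebesgue_on_indicator:
  fixes w :: "real \<Rightarrow> 'a::euclidean_space"
  assumes "integrable (lebesgue_on S) w" "S \<in> sets lebesgue" "A \<in> sets lebesgue"
  shows "(LINT t|lebesgue_on S. indicator A t *\<^sub>R w t) = integral (S \<inter> A) w"
proof -
  from lebesgue_integral_eq_integral[OF integrable_indicator_scaleR[OF assms(1,3)] assms(2)]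
  have "(LINT t|lebesgue_on S. indicator A t *\<^sub>R w t) = integral S (\<lambda>t. indicator A t *\<^sub>R w t)" .
  also have "\<dots> = integral (S \<inter> A) w"
    by (simp add: indicator_scaleR_eq_if integral_restrict_Int Int_commute)
  finally show ?thesis .
qed

text \<open>Take \<open>b = a + h\<close> in \<open>weak_derivative_trapezoid\<close>, divide by \<open>h\<close> and let \<open>h\<close> tend to 0 at a
  Lebesgue point of \<open>u\<close>.\<close>

lemma AE_primitive_of_weak_derivative:
  fixes u v :: "real \<Rightarrow> 'a::euclidean_space"
  assumes u: "integrable circle u" and v: "integrable circle v"
    and weak: "\<And>\<phi>. smooth_circle \<phi> \<Longrightarrow>
      (LINT \<theta>|circle. deriv \<phi> \<theta> *\<^sub>R u \<theta>) = - (LINT \<theta>|circle. \<phi> \<theta> *\<^sub>R v \<theta>)"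
  obtains c where "AE x in circle. u x = c + integral {0..x} v"
proof -
  have sp: "x \<in> space circle \<longleftrightarrow> 0 \<le> x \<and> x \<le> 2*pi" for x :: real
    by auto
  have iu: "u integrable_on {0..2*pi}" and iv: "v integrable_on {0..2*pi}"
    using u v by (auto intro: integrable_on_lebesgue_on)
  \<comment> \<open>Extension by zero, so that Lebesgue differentiation can be applied on the whole
    line. Outside the null set \<open>N\<close> obtained from it, averages over short intervals to
    the right of \<open>x\<close> tend to \<open>U x\<close>.\<close>
  define U where "U x = (if x \<in> {0..2*pi} then u x else 0)" for x
  have "U integrable_on UNIV"
    unfolding U_def using iu by (simp only: integrable_restrict_UNIV)
  then have "U integrable_on cbox p q" for p q
    by (rule integrable_on_subcbox) simp
  then obtain N where N: "negligible N" "\<And>x e. x \<notin> N \<Longrightarrow> 0 < e \<Longrightarrow>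
      \<exists>d>0. \<forall>h. 0 < h \<and> h < d \<longrightarrow> norm (integral {x..x + h} U /\<^sub>R h - U x) < e"
    using integrable_ccontinuous_explicit[of U] by (auto simp: cbox_interval)
  \<comment> \<open>These are the terms of the limit identity below that do not depend on
    \<open>x\<close>: the mean of \<open>u\<close>, the full integral of \<open>v\<close>, and the
    contribution of the linear part of the trapezoid.\<close>
  define c where "c = (LINT t|circle. u t) /\<^sub>R (2*pi) - integral {0..2*pi} v
    + (LINT t|circle. (t / (2*pi)) *\<^sub>R v t)"
  have "u x = c + integral {0..x} v" if x: "0 < x" "x < 2*pi" "x \<notin> N" for x
  proof -
    \<comment> \<open>Arc lengths tending to 0 for which \<open>x + h n\<close> never exceeds
      \<open>2*pi\<close>; with \<open>Suc\<close>, already the first one is well defined.\<close>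
    define h where "h n = (2*pi - x) / real (Suc n)" for n
    have h: "0 < h n" "x + h n \<le> 2*pi" for n
      using x divide_left_mono[of 1 "real (Suc n)" "2*pi - x"] by (simp_all add: h_def)
    have h_lim: "h \<longlonglongrightarrow> 0"
      unfolding h_def
      by (intro real_tendsto_divide_at_top[OF tendsto_const]
          filterlim_compose[OF filterlim_real_sequentially filterlim_Suc])
    have avg: "(\<lambda>n. integral {x..x + h n} u /\<^sub>R h n) \<longlonglongrightarrow> u x"
    proof (rule metric_LIMSEQ_I)
      fix e :: real assume "0 < e"
      obtain d where d: "0 < d"
        "\<And>h. 0 < h \<Longrightarrow> h < d \<Longrightarrow> norm (integral {x..x + h} U /\<^sub>R h - U x) < e"
        using N(2)[OF x(3) \<open>0 < e\<close>] by auto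
      obtain n0 where n0: "\<And>n. n \<ge> n0 \<Longrightarrow> h n < d"
        using order_tendstoD(2)[OF h_lim d(1)] by (auto simp: eventually_sequentially)
      have "dist (integral {x..x + h n} u /\<^sub>R h n) (u x) < e" if "n \<ge> n0" for n
      proof -
        have "integral {x..x + h n} U = integral {x..x + h n} u"
          using x h(2)[of n] by (intro integral_cong) (auto simp: U_def)
        then show ?thesis
          using d(2)[OF h(1) n0[OF that]] x by (simp add: dist_norm U_def)
      qed
      then show "\<exists>n0. \<forall>n\<ge>n0. dist (integral {x..x + h n} u /\<^sub>R h n) (u x) < e" by blast
    qed
    \<comment> \<open>The weight on \<open>v\<close> in \<open>weak_derivative_trapezoid\<close>,
      divided by the arc length. The ramp now climbs from 0 to 1 on \<open>{x..x + h n}\<close> and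
      converges to the indicator of \<open>{x<..}\<close>.\<close>
    define k where "k n t = max 0 (min t (x + h n) - x) / h n - t / (2*pi)" for n t
    have k_meas: "k n \<in> borel_measurable circle" for n
      unfolding k_def using h(1)[of n]
      by (intro continuous_imp_measurable_on_sets_lebesgue continuous_intros) auto
    have k_bound: "\<bar>k n t\<bar> \<le> 1" if "0 \<le> t" "t \<le> 2*pi" for n t
    proof -
      have "0 \<le> max 0 (min t (x + h n) - x) / h n" "max 0 (min t (x + h n) - x) / h n \<le> 1"
        using h(1)[of n] by (auto simp: field_simps max_def)
      moreover have "0 \<le> t / (2*pi)" "t / (2*pi) \<le> 1"
        using that by auto
      ultimately show ?thesis unfolding k_def by linarith
    qed
    have eq: "integral {x..x + h n} u /\<^sub>R h n
      = (LINT t|circle. u t) /\<^sub>R (2*pi) - (LINT t|circle. k n t *\<^sub>R v t)" for n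
    proof -
      have ind: "(LINT t|circle. indicator {x<..<x + h n} t *\<^sub>R u t) = integral {x..x + h n} u"
      proof -
        have "{0..2*pi} \<inter> {x<..<x + h n} = {x<..<x + h n}"
          using x h(2)[of n] by auto
        then show ?thesis
          by (simp add: LINT_lebesgue_on_indicator[OF u] integral_open_interval_real)
      qed
      have int_ind: "integrable circle (\<lambda>t. indicator {x<..<x + h n} t *\<^sub>R u t)"
        using u by (rule integrable_indicator_scaleR) simp
      have "(LINT t|circle. (indicator {x<..<x + h n} t - (x + h n - x) / (2*pi)) *\<^sub>R u t)
          = integral {x..x + h n} u - (h n / (2*pi)) *\<^sub>R (LINT t|circle. u t)"
        using int_ind u by (simp add: scaleR_diff_left ind)
      moreover have "(LINT t|circle. (max 0 (min t (x + h n) - x) - t * ((x + h n - x) / (2*pi))) *\<^sub>R v t)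
          = h n *\<^sub>R (LINT t|circle. k n t *\<^sub>R v t)"
      proof -
        have "max 0 (min t (x + h n) - x) - t * ((x + h n - x) / (2*pi)) = h n * k n t" for t
          using h(1)[of n] by (simp add: k_def right_diff_distrib)
        then show ?thesis by (simp flip: scaleR_scaleR)
      qed
      ultimately have "integral {x..x + h n} u - (h n / (2*pi)) *\<^sub>R (LINT t|circle. u t)
          = - (h n *\<^sub>R (LINT t|circle. k n t *\<^sub>R v t))"
        using weak_derivative_trapezoid[OF u v weak, of x "x + h n"] x h[of n] by simp
      then have "integral {x..x + h n} u
          = (h n / (2*pi)) *\<^sub>R (LINT t|circle. u t) - h n *\<^sub>R (LINT t|circle. k n t *\<^sub>R v t)"
        by (subst (asm) diff_eq_eq) simp
      also have "\<dots> = h n *\<^sub>R ((LINT t|circle. u t) /\<^sub>R (2*pi)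
          - (LINT t|circle. k n t *\<^sub>R v t))"
        by (simp add: scaleR_diff_right inverse_eq_divide)
      finally show ?thesis using h(1)[of n] by simp
    qed
    have "(\<lambda>n. LINT t|circle. k n t *\<^sub>R v t)
        \<longlonglongrightarrow> (LINT t|circle. (indicator {x<..} t - t / (2*pi)) *\<^sub>R v t)"
    proof (rule integral_dominated_convergence[where w = "\<lambda>t. norm (v t)"])
      have ind: "(indicator {x<..} :: real \<Rightarrow> real) \<in> borel_measurable circle"
        by (intro measurable_restrict_space1 borel_measurable_indicator) simp
      show "(\<lambda>t. (indicator {x<..} t - t / (2*pi)) *\<^sub>R v t) \<in> borel_measurable circle"
        using v by (intro borel_measurable_scaleR[OF borel_measurable_diff[OF ind]]
            continuous_imp_measurable_on_sets_lebesgue[of _ "\<lambda>t. t / (2*pi)"] continuous_intros) auto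
      show "(\<lambda>t. k n t *\<^sub>R v t) \<in> borel_measurable circle" for n
        using v by (intro borel_measurable_scaleR k_meas) auto
      show "integrable circle (\<lambda>t. norm (v t))" using v by simp
      show "AE t in circle. norm (k n t *\<^sub>R v t) \<le> norm (v t)" for n
        using k_bound by (intro AE_I2) (auto simp: sp intro!: mult_left_le_one_le)
      have k_lim: "(\<lambda>n. k n t) \<longlonglongrightarrow> indicator {x<..} t - t / (2*pi)" for t
        unfolding k_def
      proof (intro tendsto_diff tendsto_const)
        show "(\<lambda>n. max 0 (min t (x + h n) - x) / h n) \<longlonglongrightarrow> indicator {x<..} t"
        proof (cases "t \<le> x")
          case True
          then have "max 0 (min t (x + h n) - x) / h n = 0" for n by auto
          then show ?thesis using True by simp
        next
          case False
          then have "\<forall>\<^sub>F n in sequentially. h n < t - x"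
            by (intro order_tendstoD(2)[OF h_lim]) auto
          then have "\<forall>\<^sub>F n in sequentially. max 0 (min t (x + h n) - x) / h n = 1"
          proof eventually_elim
            case (elim n)
            then have "min t (x + h n) = x + h n" by simp
            then show ?case using h(1)[of n] by simp
          qed
          then show ?thesis using False by (simp add: tendsto_eventually)
        qed
      qed
      show "AE t in circle. (\<lambda>n. k n t *\<^sub>R v t) \<longlonglongrightarrow> (indicator {x<..} t - t / (2*pi)) *\<^sub>R v t"
        by (intro AE_I2 tendsto_scaleR k_lim tendsto_const)
    qed
    then have "(\<lambda>n. integral {x..x + h n} u /\<^sub>R h n) \<longlonglongrightarrow> (LINT t|circle. u t) /\<^sub>R (2*pi)
        - (LINT t|circle. (indicator {x<..} t - t / (2*pi)) *\<^sub>R v t)"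
      unfolding eq by (intro tendsto_diff tendsto_const)
    with avg have "u x = (LINT t|circle. u t) /\<^sub>R (2*pi)
        - (LINT t|circle. (indicator {x<..} t - t / (2*pi)) *\<^sub>R v t)"
      by (rule LIMSEQ_unique)
    \<comment> \<open>The indicator leaves the integral of \<open>v\<close> from \<open>x\<close> to
      \<open>2*pi\<close>. It enters \<open>u x\<close> with a minus sign; written as the full
      integral minus the integral up to \<open>x\<close>, it yields the primitive with a plus
      sign.\<close>
    also have "(LINT t|circle. (indicator {x<..} t - t / (2*pi)) *\<^sub>R v t)
        = integral {x..2*pi} v - (LINT t|circle. (t / (2*pi)) *\<^sub>R v t)"
    proof -
      have 1: "integrable circle (\<lambda>t. indicator {x<..} t *\<^sub>R v t)"
        using v by (rule integrable_indicator_scaleR) simp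
      have 2: "integrable circle (\<lambda>t. (t / (2*pi)) *\<^sub>R v t)"
        by (rule integrable_bounded_scaleR[where B = 1, OF v])
          (auto intro!: continuous_imp_measurable_on_sets_lebesgue continuous_intros)
      have "(LINT t|circle. indicator {x<..} t *\<^sub>R v t) = integral ({0..2*pi} \<inter> {x<..}) v"
        by (rule LINT_lebesgue_on_indicator[OF v]) auto
      also have "\<dots> = integral {x..2*pi} v"
        by (rule integral_spike_set) (use x in \<open>auto intro: negligible_subset[of "{x}"]\<close>)
      finally show ?thesis
        using 1 2 by (simp add: scaleR_diff_left)
    qed
    also have "integral {x..2*pi} v = integral {0..2*pi} v - integral {0..x} v"
      using Henstock_Kurzweil_Integration.integral_combine[of 0 x "2*pi" v] x iv
      by (simp add: algebra_simps)
    finally show ?thesis by (simp add: c_def algebra_simps)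
  qed
  moreover have "AE x in circle. x \<notin> N \<union> {0, 2*pi}"
    using N(1) by (intro AE_lebesgue_on_notin) auto
  moreover have "AE x in circle. x \<in> {0..2*pi}"
    by (rule AE_I2) simp
  ultimately have "AE x in circle. u x = c + integral {0..x} v"
    by (auto elim!: eventually_elim2)
  then show ?thesis by (rule that)
qed

section \<open>From almost everywhere to everywhere\<close>

lemma AE_lebesgue_onE:
  assumes "AE x in lebesgue_on S. P x" "S \<in> sets lebesgue"
  obtains N where "negligible N" "\<And>x. x \<in> S \<Longrightarrow> x \<notin> N \<Longrightarrow> P x"
proof -
  have "AE x in lebesgue. x \<in> S \<longrightarrow> P x"
    using assms by (simp add: AE_restrict_space_iff)
  then show ?thesis
    using that unfolding eventually_ae_filter_negligible by blast
qed

text \<open>A value outside \<open>C\<close> would, by continuity and openness of the complement,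
  persist on a whole relative neighbourhood, which has positive measure.\<close>

lemma continuous_AE_in_closed:
  fixes p :: "real \<Rightarrow> 'a::metric_space"
  assumes "a < b" "continuous_on {a..b} p" "closed C"
    and AE: "AE x in lebesgue_on {a..b}. p x \<in> C" and x: "x \<in> {a..b}"
  shows "p x \<in> C"
proof (rule ccontr)
  assume "p x \<notin> C"
  then obtain e where e: "0 < e" "\<And>y. dist y (p x) < e \<Longrightarrow> y \<notin> C"
    using \<open>closed C\<close> by (auto simp: closed_def open_dist)
  obtain d where d: "0 < d" "\<And>y. y \<in> {a..b} \<Longrightarrow> dist y x < d \<Longrightarrow> dist (p y) (p x) < e"
    using assms(2) x e(1) unfolding continuous_on_iff by metis
  obtain N where N: "negligible N" "\<And>y. y \<in> {a..b} \<Longrightarrow> y \<notin> N \<Longrightarrow> p y \<in> C"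
    using AE_lebesgue_onE[OF AE] by auto
  have "{max a (x - d)<..<min b (x + d)} \<subseteq> N"
  proof
    fix y assume "y \<in> {max a (x - d)<..<min b (x + d)}"
    then have "y \<in> {a..b}" "dist y x < d" by (auto simp: dist_real_def)
    then show "y \<in> N" using d(2) e(2) N(2) by blast
  qed
  then have "negligible (box (max a (x - d)) (min b (x + d)))"
    using N(1) negligible_subset by (simp add: box_real)
  then show False
    using \<open>a < b\<close> x \<open>0 < d\<close> unfolding negligible_interval by (auto simp: box_eq_empty)
qed

text \<open>Setting \<open>v\<close> to 0 on the exceptional null set keeps the integral and turns
  the bound into a pointwise one, as \<open>K\<close> is nonnegative.\<close>

lemma norm_integral_le_of_AE:
  fixes v :: "real \<Rightarrow> 'a::euclidean_space"
  assumes "AE x in lebesgue_on S. norm (v x) \<le> K" "S \<in> sets lebesgue" "0 \<le> K"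
    and v: "v integrable_on {x..y}" "{x..y} \<subseteq> S" "x \<le> y"
  shows "norm (integral {x..y} v) \<le> K * (y - x)"
proof -
  obtain N where N: "negligible N" "\<And>x. x \<in> S \<Longrightarrow> x \<notin> N \<Longrightarrow> norm (v x) \<le> K"
    using AE_lebesgue_onE[OF assms(1,2)] by blast
  define w where "w x = (if x \<in> N then 0 else v x)" for x
  have "(w has_integral integral {x..y} v) {x..y}"
    by (rule has_integral_spike[OF N(1) _ integrable_integral[OF v(1)]]) (auto simp: w_def)
  from has_integral_bound_real[OF \<open>0 \<le> K\<close> finite.emptyI this]
  show ?thesis
    using N(2) v(2,3) \<open>0 \<le> K\<close> by (force simp: w_def)
qed

section \<open>Periodic functions on the whole line\<close>

lemma periodic_add_nat:
  assumes "periodic p"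
  shows "p (x + 2 * pi * real n) = p x"
proof (induction n)
  case (Suc n)
  have "p (x + 2 * pi * real (Suc n)) = p (x + 2 * pi * real n + 2 * pi)"
    by (simp add: algebra_simps)
  with Suc show ?case using assms by (simp add: periodic_def)
qed simp

lemma periodic_obtain_period:
  assumes "periodic p"
  obtains y where "y \<in> {0..2*pi}" "p y = p x"
proof -
  define n where "n = \<lfloor>x / (2*pi)\<rfloor>"
  define y where "y = x - 2 * pi * of_int n"
  have "of_int n \<le> x / (2*pi)" "x / (2*pi) < of_int n + 1"
    by (auto simp: n_def)
  then have y: "y \<in> {0..2*pi}"
    by (auto simp: y_def field_simps)
  have "p y = p x"
  proof (cases "0 \<le> n")
    case True
    then show ?thesis
      using periodic_add_nat[OF assms, of y "nat n"] by (simp add: y_def)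
  next
    case False
    then show ?thesis
      using periodic_add_nat[OF assms, of x "nat (- n)"] by (simp add: y_def)
  qed
  with y show ?thesis using that by blast
qed

text \<open>Lipschitz bounds on adjacent intervals concatenate without loss in the constant, so
  \<open>L\<close> serves on any number of consecutive periods. Two arbitrary points are moved there
  by a common shift.\<close>

lemma periodic_lipschitz_on_UNIV:
  fixes p :: "real \<Rightarrow> 'a::metric_space"
  assumes per: "periodic p" and lip: "L-lipschitz_on {0..2*pi} p"
  shows "L-lipschitz_on UNIV p"
proof -
  have *: "L-lipschitz_on {0..2 * pi * real n} p" for n
  proof (induction n)
    case 0
    then show ?case using lipschitz_on_nonneg[OF lip] by simp
  next
    case (Suc n)
    have "L-lipschitz_on {2 * pi * real n..2 * pi * real (Suc n)} p"
    proof (rule lipschitz_onI)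
      fix x y assume xy: "x \<in> {2 * pi * real n..2 * pi * real (Suc n)}"
        "y \<in> {2 * pi * real n..2 * pi * real (Suc n)}"
      have "dist (p (x - 2 * pi * real n)) (p (y - 2 * pi * real n))
          \<le> L * dist (x - 2 * pi * real n) (y - 2 * pi * real n)"
        using xy by (intro lipschitz_onD[OF lip]) (auto simp: algebra_simps)
      then show "dist (p x) (p y) \<le> L * dist x y"
        using periodic_add_nat[OF per, of "x - 2 * pi * real n" n]
          periodic_add_nat[OF per, of "y - 2 * pi * real n" n]
        by (simp add: dist_real_def)
    qed (rule lipschitz_on_nonneg[OF lip])
    from lipschitz_on_concat[OF Suc.IH this refl] show ?case by simp
  qed
  show ?thesis
  proof (rule lipschitz_onI)
    fix x y :: real
    obtain n where n: "(\<bar>x\<bar> + \<bar>y\<bar>) / (2*pi) \<le> real n"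
      using real_arch_simple by blast
    then have n: "\<bar>x\<bar> + \<bar>y\<bar> \<le> 2*pi * real n" by (simp add: field_simps)
    \<comment> \<open>As both absolute values are at most \<open>2*pi * real n\<close>, a shift by
      \<open>n\<close> periods lands both points in the first \<open>2*n\<close> periods.\<close>
    have "x + 2*pi * real n \<in> {0..2*pi * real (2*n)}" "y + 2*pi * real n \<in> {0..2*pi * real (2*n)}"
      using n by (auto simp: algebra_simps)
    from lipschitz_onD[OF *[of "2*n"] this] show "dist (p x) (p y) \<le> L * dist x y"
      by (simp add: periodic_add_nat[OF per] dist_real_def)
  qed (rule lipschitz_on_nonneg[OF lip])
qed

section \<open>Sobolev functions on the circle\<close>

lemma integrable_circle_const: "integrable circle (\<lambda>x. c :: 'a::euclidean_space)"
proof -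
  have "finite_measure circle"
    by (intro finite_measureI) (auto simp: emeasure_restrict_space)
  then show ?thesis by (rule finite_measure.integrable_const)
qed

lemma L2_circle_integrable:
  fixes p :: "real \<Rightarrow> 'a::euclidean_space"
  assumes "L2_circle p"
  shows "integrable circle p"
proof (rule Bochner_Integration.integrable_bound)
  show "integrable circle (\<lambda>x. 1 + (norm (p x))\<^sup>2)"
    using assms integrable_circle_const by (auto simp: L2_circle_def)
  show "p \<in> borel_measurable circle" using assms by (simp add: L2_circle_def)
  have "s \<le> 1 + s\<^sup>2" for s :: real
    using zero_le_power2[of s] zero_le_power2[of "s - 1"]
    unfolding power2_diff power_one mult_1_right by linarith
  then show "AE x in circle. norm (p x) \<le> norm (1 + (norm (p x))\<^sup>2)"
    by (intro AE_I2) (simp add: abs_of_nonneg)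
qed

text \<open>The continuous representative is absolutely continuous: \<open>g\<close> minus the
  primitive of \<open>g'\<close> is continuous and almost everywhere constant, hence constant by
  \<open>continuous_AE_in_closed\<close> with a singleton.\<close>

lemma W12_circle_integral_eq:
  fixes g g' :: "real \<Rightarrow> 'a::euclidean_space"
  assumes "W12_circle g g'" "continuous_on {0..2*pi} g" and xy: "0 \<le> x" "x \<le> y" "y \<le> 2*pi"
  shows "g y - g x = integral {x..y} g'"
proof -
  have g: "integrable circle g" and g': "integrable circle g'"
    using assms(1) L2_circle_integrable by (auto simp: W12_circle_def)
  have int: "g' integrable_on {0..2*pi}"
    using g' by (auto intro: integrable_on_lebesgue_on)
  obtain c where c: "AE x in circle. g x = c + integral {0..x} g'"
    using AE_primitive_of_weak_derivative[OF g g'] assms(1)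
    by (auto simp: W12_circle_def weak_deriv_circle_def)
  have "g x - integral {0..x} g' = c" if "x \<in> {0..2*pi}" for x
  proof -
    have "g x - integral {0..x} g' \<in> {c}"
    proof (rule continuous_AE_in_closed[where p = "\<lambda>x. g x - integral {0..x} g'", OF _ _ _ _ that])
      show "continuous_on {0..2*pi} (\<lambda>x. g x - integral {0..x} g')"
        by (intro continuous_intros assms(2) indefinite_integral_continuous_1 int)
      show "AE x in circle. g x - integral {0..x} g' \<in> {c}"
        using c by eventually_elim (auto simp: algebra_simps)
    qed auto
    then show ?thesis by simp
  qed
  then have "g y = c + integral {0..y} g'" "g x = c + integral {0..x} g'"
    using xy by (auto simp: diff_eq_eq)
  moreover have "integral {0..x} g' + integral {x..y} g' = integral {0..y} g'"
    using xy int
    by (intro Henstock_Kurzweil_Integration.integral_combine integrable_on_subinterval[OF int]) auto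
  ultimately show ?thesis by (simp flip: add_diff_eq) (simp add: diff_eq_eq add.commute)
qed

text \<open>From right to left, integrate \<open>g'\<close> and extend by periodicity. From left to
  right, at a Lebesgue point \<open>g'\<close> is the limit of its averages, which are difference
  quotients of \<open>g\<close>. The constant is the same in both directions.\<close>

lemma W12_circle_lipschitz_iff:
  fixes g g' :: "real \<Rightarrow> 'a::euclidean_space"
  assumes W: "W12_circle g g'" and cont: "continuous_on UNIV g" and L: "0 \<le> L"
  shows "L-lipschitz_on UNIV g \<longleftrightarrow> (AE x in circle. norm (g' x) \<le> L)"
proof
  have int: "g' integrable_on {0..2*pi}"
    using W by (intro integrable_on_lebesgue_on L2_circle_integrable) (auto simp: W12_circle_def)
  have eq: "g y - g x = integral {x..y} g'" if "0 \<le> x" "x \<le> y" "y \<le> 2*pi" for x y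
    using W12_circle_integral_eq[OF W continuous_on_subset[OF cont] that] by simp
  {
    assume AE: "AE x in circle. norm (g' x) \<le> L"
    have "L-lipschitz_on {0..2*pi} g"
    proof (rule lipschitz_on_leI)
      fix x y assume xy: "x \<in> {0..2*pi}" "y \<in> {0..2*pi}" "x \<le> y"
      have "g' integrable_on {x..y}"
        using xy by (intro integrable_on_subinterval[OF int]) auto
      then have "norm (integral {x..y} g') \<le> L * (y - x)"
        using xy L by (intro norm_integral_le_of_AE[OF AE]) auto
      then show "dist (g x) (g y) \<le> L * dist x y"
        using eq[of x y] xy norm_minus_commute[of "g x" "g y"] by (simp add: dist_norm)
    qed (rule L)
    then show "L-lipschitz_on UNIV g"
      using W by (intro periodic_lipschitz_on_UNIV) (auto simp: W12_circle_def L2_circle_def)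
  next
    assume lip: "L-lipschitz_on UNIV g"
    define V where "V x = (if x \<in> {0..2*pi} then g' x else 0)" for x
    have "V integrable_on UNIV"
      unfolding V_def using int by (simp only: integrable_restrict_UNIV)
    then have "V integrable_on cbox p q" for p q
      by (rule integrable_on_subcbox) simp
    then obtain N where N: "negligible N" "\<And>x e. x \<notin> N \<Longrightarrow> 0 < e \<Longrightarrow>
        \<exists>d>0. \<forall>h. 0 < h \<and> h < d \<longrightarrow> norm (integral {x..x + h} V /\<^sub>R h - V x) < e"
      using integrable_ccontinuous_explicit[of V] by (auto simp: cbox_interval)
    have "norm (g' x) \<le> L" if x: "0 < x" "x < 2*pi" "x \<notin> N" for x
    proof (rule field_le_epsilon)
      fix e :: real assume "0 < e"
      obtain d where d: "0 < d"
        "\<And>h. 0 < h \<Longrightarrow> h < d \<Longrightarrow> norm (integral {x..x + h} V /\<^sub>R h - V x) < e"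
        using N(2)[OF x(3) \<open>0 < e\<close>] by auto
      \<comment> \<open>Halving gives \<open>h < d\<close> strictly; the second argument keeps
        \<open>x + h\<close> in the period on which \<open>V\<close> agrees with
        \<open>g'\<close>.\<close>
      define h where "h = min (d/2) (2*pi - x)"
      have h: "0 < h" "h < d" "x + h \<le> 2*pi"
        using x d(1) by (auto simp: h_def)
      have "integral {x..x + h} V = integral {x..x + h} g'"
        using x h by (intro integral_cong) (auto simp: V_def)
      also have "\<dots> = g (x + h) - g x"
        using x h by (intro eq[symmetric]) auto
      finally have "norm (integral {x..x + h} V) \<le> L * h"
        using lipschitz_on_normD[OF lip, of "x + h" x] h by simp
      then have "norm (integral {x..x + h} V /\<^sub>R h) \<le> L"
        using h by (simp add: field_simps)
      moreover have "norm (V x) - norm (integral {x..x + h} V /\<^sub>R h) < e"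
        using d(2)[OF h(1,2)] norm_triangle_ineq2[of "V x" "integral {x..x + h} V /\<^sub>R h"]
        by (simp add: norm_minus_commute)
      ultimately show "norm (g' x) \<le> L + e"
        using x by (simp add: V_def)
    qed
    moreover have "AE x in circle. x \<notin> N \<union> {0, 2*pi}"
      using N(1) by (intro AE_lebesgue_on_notin) auto
    moreover have "AE x in circle. x \<in> {0..2*pi}"
      by (rule AE_I2) simp
    ultimately show "AE x in circle. norm (g' x) \<le> L"
      by (auto elim!: eventually_elim2)
  }
qed

section \<open>Consequences of weak equations\<close>

lemma smooth_circle_differentiable:
  assumes "smooth_circle \<phi>"
  shows "\<phi> field_differentiable at x" "deriv \<phi> field_differentiable at x"
  using assms unfolding smooth_circle_def
  by (metis funpow_0, metis funpow_0 funpow_Suc_right o_apply)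

lemma smooth_circle_continuous_on:
  assumes "smooth_circle \<phi>"
  shows "continuous_on S \<phi>" "continuous_on S (deriv \<phi>)"
  by (intro continuous_at_imp_continuous_on ballI field_differentiable_imp_continuous_at
      smooth_circle_differentiable[OF assms])+

lemma integrable_circle_continuous_scaleR:
  fixes u :: "real \<Rightarrow> 'a::euclidean_space"
  assumes "integrable circle u" "continuous_on {0..2*pi} w"
  shows "integrable circle (\<lambda>x. w x *\<^sub>R u x)"
proof -
  have "bounded (w ` {0..2*pi})"
    using assms(2) by (intro compact_imp_bounded compact_continuous_image) auto
  then obtain B where "\<forall>x\<in>{0..2*pi}. \<bar>w x\<bar> \<le> B"
    by (auto simp: bounded_real)
  then show ?thesis
    using assms
    by (intro integrable_bounded_scaleR[of _ _ _ B] continuous_imp_measurable_on_sets_lebesgue) auto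
qed

text \<open>The equation says that \<open>u\<close> has weak derivative 0, so \<open>u\<close> is
  almost everywhere a constant plus the primitive of 0.\<close>

lemma du_Bois_Reymond:
  fixes u :: "real \<Rightarrow> real"
  assumes "\<And>\<phi>. smooth_circle \<phi> \<Longrightarrow>
    integrable circle (\<lambda>x. u x * deriv \<phi> x) \<and> (LINT x|circle. u x * deriv \<phi> x) = 0"
  obtains c where "AE x in circle. u x = c"
proof -
  have s: "smooth_circle (\<lambda>x. sin (x + c))" for c
    using sin_periodic[of "x + c" for x]
    by (intro smooth_circle_tanh_trig tanh_trig.intros) (simp add: periodic_def algebra_simps)
  have d: "deriv (\<lambda>x. sin (x + c)) = (\<lambda>x. cos (x + c))" for c :: real
    by (auto intro!: DERIV_imp_deriv derivative_eq_intros)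
  \<comment> \<open>Only products of \<open>u\<close> with derivatives of test functions are known
    to be integrable. Testing with two sines a quarter period apart and multiplying by the bounded
    derivatives again gives u cos^2 and u sin^2, whose sum is \<open>u\<close>.\<close>
  have "integrable circle (\<lambda>x. cos (x + c) *\<^sub>R (u x * cos (x + c)))" for c
    using assms[OF s[of c]] by (intro integrable_circle_continuous_scaleR continuous_intros) (simp add: d)
  from Bochner_Integration.integrable_add[OF this[of 0] this[of "pi/2"]]
  have "integrable circle (\<lambda>x. cos x * (u x * cos x) + sin x * (u x * sin x))"
    by (simp add: cos_add)
  moreover have "cos x * (u x * cos x) + sin x * (u x * sin x) = u x * ((sin x)\<^sup>2 + (cos x)\<^sup>2)" for x
    by (simp only: power2_eq_square algebra_simps)
  ultimately have u: "integrable circle u" by simp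
  have "(LINT x|circle. deriv \<phi> x *\<^sub>R u x) = - (LINT x|circle. \<phi> x *\<^sub>R 0)"
    if "smooth_circle \<phi>" for \<phi>
    using assms[OF that] by (simp add: mult.commute)
  from AE_primitive_of_weak_derivative[OF u integrable_circle_const this]
  show ?thesis using that by auto
qed

text \<open>Here \<open>v\<close> is the weak derivative of \<open>u\<close>, so \<open>u\<close>
  agrees almost everywhere with an indefinite integral, which is continuous on a compact
  interval.\<close>

lemma AE_bounded_of_weak_derivative:
  fixes u v :: "real \<Rightarrow> real"
  assumes u: "integrable circle u"
    and weak: "\<And>\<phi>. smooth_circle \<phi> \<Longrightarrow> integrable circle (\<lambda>x. v x * \<phi> x + u x * deriv \<phi> x) \<and>
      (LINT x|circle. v x * \<phi> x + u x * deriv \<phi> x) = 0"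
  obtains B where "AE x in circle. \<bar>u x\<bar> \<le> B"
proof -
  \<comment> \<open>For the constant test function the term with \<open>u\<close> drops out, which
    leaves the integrability of \<open>v\<close>.\<close>
  have "smooth_circle (\<lambda>x. 1)"
    by (intro smooth_circle_tanh_trig tanh_trig.intros) (simp add: periodic_def)
  from weak[OF this] have v: "integrable circle v" by simp
  have "(LINT x|circle. deriv \<phi> x *\<^sub>R u x) = - (LINT x|circle. \<phi> x *\<^sub>R v x)"
    if \<phi>: "smooth_circle \<phi>" for \<phi>
  proof -
    have "integrable circle (\<lambda>x. deriv \<phi> x *\<^sub>R u x)" "integrable circle (\<lambda>x. \<phi> x *\<^sub>R v x)"
      by (intro integrable_circle_continuous_scaleR u v smooth_circle_continuous_on \<phi>)+
    then have "(LINT x|circle. \<phi> x *\<^sub>R v x + deriv \<phi> x *\<^sub>R u x)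
        = (LINT x|circle. \<phi> x *\<^sub>R v x) + (LINT x|circle. deriv \<phi> x *\<^sub>R u x)"
      by (intro Bochner_Integration.integral_add)
    then show ?thesis
      using weak[OF \<phi>] by (simp add: mult.commute)
  qed
  from AE_primitive_of_weak_derivative[OF u v this]
  obtain c where c: "AE x in circle. u x = c + integral {0..x} v" by blast
  have "v integrable_on {0..2*pi}"
    using v by (auto intro: integrable_on_lebesgue_on)
  then have "continuous_on {0..2*pi} (\<lambda>x. c + integral {0..x} v)"
    by (intro continuous_intros indefinite_integral_continuous_1)
  then have "bounded ((\<lambda>x. c + integral {0..x} v) ` {0..2*pi})"
    by (intro compact_imp_bounded compact_continuous_image) auto
  then obtain B where B: "\<forall>x\<in>{0..2*pi}. \<bar>c + integral {0..x} v\<bar> \<le> B"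
    by (auto simp: bounded_real)
  have "AE x in circle. x \<in> {0..2*pi}"
    by (rule AE_I2) simp
  with c have "AE x in circle. \<bar>u x\<bar> \<le> B"
    by eventually_elim (use B in auto)
  then show ?thesis by (rule that)
qed

section \<open>The energy density\<close>

lemma admissible_derivs:
  assumes "admissible h" "0 < t"
  shows "(fin h has_real_derivative deriv (fin h) t) (at t)"
    and "(deriv (fin h) has_real_derivative deriv (deriv (fin h)) t) (at t)"
    and "0 \<le> deriv (deriv (fin h)) t"
proof -
  show "(fin h has_real_derivative deriv (fin h) t) (at t)"
    "(deriv (fin h) has_real_derivative deriv (deriv (fin h)) t) (at t)"
    using assms by (auto simp: admissible_def C2_on_def field_differentiable_derivI)
  obtain \<mu> where "\<mu> > 0" "\<forall>t>0. \<mu> \<le> deriv (deriv (fin h)) t"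
    using assms(1) unfolding admissible_def by blast
  then show "0 \<le> deriv (deriv (fin h)) t"
    using assms(2) by force
qed

text \<open>The derivative of t h'(t) - h(t) is t h''(t), which is nonnegative by convexity.\<close>

lemma f_of_mono:
  assumes h: "admissible h" and st: "0 < s" "s \<le> t"
  shows "f_of h s \<le> f_of h t"
proof (rule DERIV_nonneg_imp_nondecreasing[OF st(2)])
  fix x assume "s \<le> x" "x \<le> t"
  with st have x: "0 < x" by simp
  have "(f_of h has_real_derivative x * deriv (deriv (fin h)) x) (at x)"
    unfolding f_of_def
    by (auto intro!: derivative_eq_intros admissible_derivs[OF h x])
  moreover have "0 \<le> x * deriv (deriv (fin h)) x"
    using x admissible_derivs(3)[OF h x] by simp
  ultimately show "\<exists>y. (f_of h has_real_derivative y) (at x) \<and> 0 \<le> y" by blast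
qed

text \<open>This carries the blow-up of \<open>h\<close> at 0 over to \<open>f_of h\<close>. By
  convexity the tangent at \<open>t\<close> lies below the graph at 1, so (1 - t) h'(t) \<le> h(1) -
  h(t). If h'(t) is positive, \<open>t \<le> 1/2\<close> allows replacing 1 - t by the smaller
  \<open>t\<close>; otherwise t h'(t) \<le> 0 already suffices.\<close>

lemma f_of_le:
  assumes h: "admissible h" and t: "0 < t" "t \<le> 1/2"
  shows "f_of h t \<le> fin h 1 - fin h t"
proof -
  obtain z where z: "t < z" "z < 1" "fin h 1 - fin h t = (1 - t) * deriv (fin h) z"
    using MVT2[of t 1 "fin h" "deriv (fin h)"] admissible_derivs(1)[OF h] t by auto
  have "deriv (fin h) t \<le> deriv (fin h) z"
  proof (rule DERIV_nonneg_imp_nondecreasing[of t z "deriv (fin h)"])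
    fix x assume "t \<le> x" "x \<le> z"
    with t have "0 < x" by simp
    with admissible_derivs[OF h this]
    show "\<exists>y. (deriv (fin h) has_real_derivative y) (at x) \<and> 0 \<le> y" by blast
  qed (use z in simp)
  then have tangent: "(1 - t) * deriv (fin h) t \<le> fin h 1 - fin h t"
    unfolding z(3) using t by (intro mult_left_mono) auto
  have nn: "0 \<le> fin h s" for s by (simp add: fin_def)
  show ?thesis
  proof (cases "deriv (fin h) t \<le> 0")
    case True
    then have "t * deriv (fin h) t \<le> 0" using t by (simp add: mult_nonneg_nonpos)
    then show ?thesis using nn[of 1] by (simp add: f_of_def)
  next
    case False
    then have "t * deriv (fin h) t \<le> (1 - t) * deriv (fin h) t"
      using t by (intro mult_right_mono) auto
    then show ?thesis using tangent nn[of t] by (simp add: f_of_def)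
  qed
qed

lemma f_of_lower_bound_imp:
  assumes h: "admissible h"
  obtains \<delta> where "0 < \<delta>" "\<And>t. 0 < t \<Longrightarrow> M \<le> f_of h t \<Longrightarrow> \<delta> \<le> t"
proof -
  \<comment> \<open>Chosen so that \<open>fin h t > K\<close> forces
    \<open>fin h 1 - fin h t < M\<close>, and thus \<open>f_of h t < M\<close> by
    \<open>f_of_le\<close>.\<close>
  define K where "K = \<bar>fin h 1\<bar> + \<bar>M\<bar>"
  have K: "0 \<le> K" by (simp add: K_def)
  have "(h \<longlongrightarrow> \<infinity>) (at_right 0)"
    using h by (simp add: admissible_def)
  then have "\<forall>\<^sub>F t in at_right 0. ennreal K < h t"
    by (rule order_tendstoD) simp
  then obtain b where b: "0 < b" "\<And>t. 0 < t \<Longrightarrow> t < b \<Longrightarrow> ennreal K < h t"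
    unfolding eventually_at_right_field by auto
  show ?thesis
  proof (rule that[of "min b (1/2)"])
    show "0 < min b (1/2)" using b by simp
    fix t assume t: "0 < t" "M \<le> f_of h t"
    show "min b (1/2) \<le> t"
    proof (rule ccontr)
      assume "\<not> min b (1/2) \<le> t"
      then have "t < b" "t \<le> 1/2" by auto
      have "h t < \<infinity>" using h t by (simp add: admissible_def)
      then have "h t = ennreal (fin h t)" by (simp add: fin_def)
      with b(2)[OF t(1) \<open>t < b\<close>] have "K < fin h t"
        using K by (simp add: ennreal_less_iff)
      with f_of_le[OF h t(1) \<open>t \<le> 1/2\<close>] t(2) show False
        by (simp add: K_def)
    qed
  qed
qed

section \<open>The determinant of the gradient\<close>

lemma jac_le: "jac g g' x \<le> norm (g x) * norm (g' x)"
proof -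
  have "norm (J *v g x) = norm (g x)"
    by (simp add: norm_eq_sqrt_inner inner_vec_def sum_2 J_def matrix_vector_mult_def add.commute)
  then show ?thesis
    using norm_cauchy_schwarz[of "J *v g x" "g' x"] by (simp add: jac_eq)
qed

text \<open>Lagrange's identity in the plane: \<open>g x\<close> and \<open>J *v g x\<close> are
  orthogonal and of equal length, and the right-hand side collects the components of
  \<open>g' x\<close> along them.\<close>

lemma norm_product_eq_inner_jac:
  "(norm (g x))\<^sup>2 * (norm (g' x))\<^sup>2 = (g' x \<bullet> g x)\<^sup>2 + (jac g g' x)\<^sup>2"
proof -
  have "(a\<^sup>2 + b\<^sup>2) * (c\<^sup>2 + d\<^sup>2) = (c * a + d * b)\<^sup>2 + (a * d - b * c)\<^sup>2" for a b c d :: real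
    by (simp add: power2_eq_square algebra_simps)
  from this[of "g x $ 1" "g x $ 2" "g' x $ 1" "g' x $ 2"]
  show ?thesis
    unfolding power2_norm_eq_inner jac_eq
    by (simp add: inner_vec_def sum_2 J_def matrix_vector_mult_def power2_eq_square algebra_simps)
qed

lemma le_ess_inf_iff:
  assumes "p \<in> borel_measurable M"
  shows "ereal c \<le> ess_inf M p \<longleftrightarrow> (AE x in M. c \<le> p x)"
proof
  have m: "(\<lambda>x. - ereal (p x)) \<in> borel_measurable M" using assms by simp
  assume "AE x in M. c \<le> p x"
  then have "AE x in M. - ereal (p x) \<le> ereal (- c)" by simp
  from esssup_I[OF m this] show "ereal c \<le> ess_inf M p"
    using ereal_minus_le_minus[of "ereal (- c)" "esssup M (\<lambda>x. - ereal (p x))"]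
    by (simp add: ess_inf_def)
next
  assume "ereal c \<le> ess_inf M p"
  then have le: "esssup M (\<lambda>x. - ereal (p x)) \<le> - ereal c"
    using ereal_minus_le_minus[of "ereal (- c)" "esssup M (\<lambda>x. - ereal (p x))"]
    by (simp add: ess_inf_def)
  from esssup_AE[of "\<lambda>x. - ereal (p x)" M] show "AE x in M. c \<le> p x"
  proof eventually_elim
    case (elim x)
    from order_trans[OF this le] show ?case by simp
  qed
qed

text \<open>\<open>h\<close> is infinite on the nonpositive half-line, so a set of positive measure
  on which the determinant is nonpositive would make the energy infinite.\<close>

lemma jac_pos:
  assumes h: "admissible h" and W: "W12_circle g g'" and E: "energy h g g' < \<infinity>"
  shows "jac g g' \<in> borel_measurable circle" "AE x in circle. 0 < jac g g' x"
proof -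
  have [measurable]: "g \<in> borel_measurable circle" "g' \<in> borel_measurable circle"
    using W by (auto simp: W12_circle_def L2_circle_def)
  \<comment> \<open>Coordinates written as inner products with \<open>axis\<close> vectors make
    measurability follow from that of \<open>g\<close> and \<open>g'\<close>.\<close>
  have "jac g g' = (\<lambda>x. (g x \<bullet> axis 1 1) * (g' x \<bullet> axis 2 1) - (g x \<bullet> axis 2 1) * (g' x \<bullet> axis 1 1))"
    by (simp add: fun_eq_iff jac_eq J_def matrix_vector_mult_def inner_vec_def[of "vec_lambda _"]
        sum_2 inner_axis)
  then show [measurable]: "jac g g' \<in> borel_measurable circle"
    by simp
  define A where "A = {x \<in> space circle. jac g g' x \<le> 0}"
  have [measurable]: "A \<in> sets circle" unfolding A_def by measurable
  have "\<infinity> * indicator A x \<le> W h (grad_u g g' x)" for x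
    using h by (auto simp: W_def A_def jac_def admissible_def indicator_def)
  then have "(\<integral>\<^sup>+x. \<infinity> * indicator A x \<partial>circle) \<le> energy h g g'"
    unfolding energy_def by (rule nn_integral_mono)
  then have "\<infinity> * emeasure circle A < \<infinity>"
    using E by (simp add: nn_integral_cmult_indicator)
  then have "emeasure circle A = 0"
    by (auto simp: ennreal_top_mult split: if_splits)
  then have "AE x in circle. x \<notin> A"
    by (intro AE_not_in) (auto simp: null_sets_def)
  then show "AE x in circle. 0 < jac g g' x"
    by (rule AE_mp) (rule AE_I2, auto simp: A_def)
qed

section \<open>The equivalences for Lipschitz continuity and zeros\<close>

theorem proposition4p3:
  fixes h :: "real \<Rightarrow> ennreal" and g g' :: "real \<Rightarrow> real^2"
  assumes "admissible h"
    and "W12_circle g g'" and "continuous_on UNIV g"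
    and "energy h g g' < \<infinity>"
    and "\<And>\<phi>. smooth_circle \<phi> \<Longrightarrow>
           integrable circle (\<lambda>\<theta>.
             (f_of h (jac g g' \<theta>) + 1/2 * (norm (g' \<theta>))\<^sup>2 - 1/2 * (norm (g \<theta>))\<^sup>2) * deriv \<phi> \<theta>) \<and>
           (LINT \<theta>|circle.
             (f_of h (jac g g' \<theta>) + 1/2 * (norm (g' \<theta>))\<^sup>2 - 1/2 * (norm (g \<theta>))\<^sup>2) * deriv \<phi> \<theta>) = 0"
    and "\<And>\<phi>. smooth_circle \<phi> \<Longrightarrow>
           integrable circle (\<lambda>\<theta>.
             ((norm (g' \<theta>))\<^sup>2 + (norm (g \<theta>))\<^sup>2 + 2 * jac g g' \<theta> * deriv (fin h) (jac g g' \<theta>)) * \<phi> \<theta>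
             + (g' \<theta> \<bullet> g \<theta>) * deriv \<phi> \<theta>) \<and>
           (LINT \<theta>|circle.
             ((norm (g' \<theta>))\<^sup>2 + (norm (g \<theta>))\<^sup>2 + 2 * jac g g' \<theta> * deriv (fin h) (jac g g' \<theta>)) * \<phi> \<theta>
             + (g' \<theta> \<bullet> g \<theta>) * deriv \<phi> \<theta>) = 0"
  shows "(ess_inf circle (jac g g') = 0 \<longleftrightarrow> (\<exists>\<theta>\<^sub>0. g \<theta>\<^sub>0 = 0)) \<and>
         ((\<exists>L. L-lipschitz_on UNIV g) \<longleftrightarrow> (\<forall>\<theta>. g \<theta> \<noteq> 0))"
proof -
  note h = assms(1) and W = assms(2) and cont = assms(3)
  have d_meas: "jac g g' \<in> borel_measurable circle" and d_pos: "AE x in circle. 0 < jac g g' x"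
    using jac_pos[OF h W assms(4)] .
  have per: "periodic g" using W by (simp add: W12_circle_def L2_circle_def)
  have circ: "AE x in circle. x \<in> {0..2*pi}"
    by (rule AE_I2) simp
  have cont': "continuous_on {0..2*pi} g"
    using cont continuous_on_subset by blast
  have "bounded (g ` {0..2*pi})"
    using cont' by (intro compact_imp_bounded compact_continuous_image) auto
  then obtain G where G: "\<forall>x\<in>{0..2*pi}. norm (g x) \<le> G"
    unfolding bounded_iff by auto
  obtain c where c: "AE x in circle.
      f_of h (jac g g' x) + 1/2 * (norm (g' x))\<^sup>2 - 1/2 * (norm (g x))\<^sup>2 = c"
    using du_Bois_Reymond[OF assms(5)] by blast
  \<comment> \<open>By Cauchy-Schwarz and 2ab \<le> a^2 + b^2 the product is dominated by the sum of
    the squares. Its integrability separates the two terms of the second equation in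
    \<open>AE_bounded_of_weak_derivative\<close>.\<close>
  have Q: "integrable circle (\<lambda>x. g' x \<bullet> g x)"
  proof (rule Bochner_Integration.integrable_bound)
    show "integrable circle (\<lambda>x. (norm (g' x))\<^sup>2 + (norm (g x))\<^sup>2)"
      using W by (auto simp: W12_circle_def L2_circle_def)
    show "(\<lambda>x. g' x \<bullet> g x) \<in> borel_measurable circle"
      using W by (auto simp: W12_circle_def L2_circle_def intro!: borel_measurable_inner)
    have "\<bar>g' x \<bullet> g x\<bar> \<le> (norm (g' x))\<^sup>2 + (norm (g x))\<^sup>2" for x
    proof -
      have "\<bar>g' x \<bullet> g x\<bar> \<le> norm (g' x) * norm (g x)" by (rule Cauchy_Schwarz_ineq2)
      moreover have "0 \<le> norm (g' x) * norm (g x)" by simp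
      ultimately show ?thesis
        using sum_squares_bound[of "norm (g' x)" "norm (g x)"] by linarith
    qed
    then show "AE x in circle. norm (g' x \<bullet> g x) \<le> norm ((norm (g' x))\<^sup>2 + (norm (g x))\<^sup>2)"
      by (intro AE_I2) simp
  qed
  obtain B where B: "AE x in circle. \<bar>g' x \<bullet> g x\<bar> \<le> B"
    using AE_bounded_of_weak_derivative[OF Q assms(6)] by blast

  \<comment> \<open>The common link: \<open>D\<close> is shown equivalent to \<open>g\<close> being
    Lipschitz, to \<open>g\<close> having no zero, and to the essential infimum being
    nonzero.\<close>
  define D where "D \<longleftrightarrow> (\<exists>\<delta>>0. AE x in circle. \<delta> \<le> jac g g' x)"

  have D_imp_lip: "\<exists>L. L-lipschitz_on UNIV g" if D
  proof -
    from that obtain \<delta> where \<delta>: "0 < \<delta>" "AE x in circle. \<delta> \<le> jac g g' x"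
      unfolding D_def by blast
    \<comment> \<open>Solving the first equation for |g'|^2 gives 2c + |g|^2 - 2f(d), at most 2c +
      G^2 - 2f(\<delta>) by monotonicity of f. The absolute value ensures that \<open>L\<close> is
      nonnegative.\<close>
    define L where "L = sqrt \<bar>2 * c + G\<^sup>2 - 2 * f_of h \<delta>\<bar>"
    have "AE x in circle. norm (g' x) \<le> L"
      using \<delta>(2) c circ
    proof eventually_elim
      case (elim x)
      have "f_of h \<delta> \<le> f_of h (jac g g' x)"
        using f_of_mono[OF h \<delta>(1)] elim by blast
      moreover have "(norm (g x))\<^sup>2 \<le> G\<^sup>2"
        using G elim by (intro power_mono) auto
      ultimately have "(norm (g' x))\<^sup>2 \<le> \<bar>2 * c + G\<^sup>2 - 2 * f_of h \<delta>\<bar>"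
        using elim by linarith
      then show ?case unfolding L_def by (rule real_le_rsqrt)
    qed
    then show ?thesis
      using W12_circle_lipschitz_iff[OF W cont, of L] by (auto simp: L_def)
  qed

  have lip_imp_D: D if lip: "L-lipschitz_on UNIV g" for L
  proof -
    have L: "0 \<le> L" using lip by (rule lipschitz_on_nonneg)
    \<comment> \<open>The threshold is what the first equation leaves for f(d) once |g'| \<le> L is
      inserted and |g|^2/2 is dropped.\<close>
    obtain \<delta> where \<delta>: "0 < \<delta>" "\<And>t. 0 < t \<Longrightarrow> c - 1/2 * L\<^sup>2 \<le> f_of h t \<Longrightarrow> \<delta> \<le> t"
      using f_of_lower_bound_imp[OF h] by blast
    have "AE x in circle. norm (g' x) \<le> L"
      using W12_circle_lipschitz_iff[OF W cont L] lip by simp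
    then have "AE x in circle. \<delta> \<le> jac g g' x"
      using c d_pos
    proof eventually_elim
      case (elim x)
      have "(norm (g' x))\<^sup>2 \<le> L\<^sup>2"
        using elim by (intro power_mono) auto
      moreover have "0 \<le> (norm (g x))\<^sup>2" by simp
      ultimately have "c - 1/2 * L\<^sup>2 \<le> f_of h (jac g g' x)"
        using elim by linarith
      with elim show ?case by (intro \<delta>(2))
    qed
    with \<delta>(1) show ?thesis unfolding D_def by blast
  qed

  have D_imp_nonzero: "g x \<noteq> 0" if D for x
  proof -
    from that obtain \<delta> where \<delta>: "0 < \<delta>" "AE x in circle. \<delta> \<le> jac g g' x"
      unfolding D_def by blast
    from D_imp_lip[OF that] obtain L where lip: "L-lipschitz_on UNIV g" by blast
    have L: "0 \<le> L" using lip by (rule lipschitz_on_nonneg)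
    have AE_L: "AE x in circle. norm (g' x) \<le> L"
      using W12_circle_lipschitz_iff[OF W cont L] lip by simp
    obtain y where y: "y \<in> {0..2*pi}" "g y = g x"
      using periodic_obtain_period[OF per] by blast
    \<comment> \<open>Almost everywhere \<delta> \<le> d \<le> |g| |g'| \<le> |g| L. The last
      expression is continuous, so the bound holds at every point of the period, in particular at
      the representative \<open>y\<close> of \<open>x\<close>.\<close>
    have "norm (g y) * L \<in> {\<delta>..}"
    proof (rule continuous_AE_in_closed[where p = "\<lambda>x. norm (g x) * L", OF _ _ _ _ y(1)])
      show "continuous_on {0..2*pi} (\<lambda>x. norm (g x) * L)"
        by (intro continuous_intros cont')
      show "AE x in circle. norm (g x) * L \<in> {\<delta>..}"
        using \<delta>(2) AE_L
      proof eventually_elim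
        case (elim x)
        have "norm (g x) * norm (g' x) \<le> norm (g x) * L"
          using elim by (intro mult_left_mono) auto
        with jac_le[of g g' x] elim show ?case by simp
      qed
    qed auto
    with \<delta>(1) y(2) show ?thesis by auto
  qed

  have nonzero_imp_D: D if nz: "\<And>x. g x \<noteq> 0"
  proof -
    have "\<exists>z\<in>{0..2*pi}. \<forall>x\<in>{0..2*pi}. norm (g z) \<le> norm (g x)"
      by (intro continuous_attains_inf continuous_on_norm cont') auto
    then obtain z where z: "\<forall>x\<in>{0..2*pi}. norm (g z) \<le> norm (g x)" by blast
    define m where "m = norm (g z)"
    have m: "0 < m" "\<And>x. x \<in> {0..2*pi} \<Longrightarrow> m \<le> norm (g x)"
      using nz z by (auto simp: m_def)
    \<comment> \<open>Where d \<le> 1, \<open>norm_product_eq_inner_jac\<close> gives m^2 |g'|^2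
      \<le> B^2 + 1; the first equation turns this into the stated lower bound on f(d).\<close>
    obtain \<delta> where \<delta>: "0 < \<delta>"
      "\<And>t. 0 < t \<Longrightarrow> c - 1/2 * ((B\<^sup>2 + 1) / m\<^sup>2) \<le> f_of h t \<Longrightarrow> \<delta> \<le> t"
      using f_of_lower_bound_imp[OF h] by blast
    \<comment> \<open>The bound 1 covers the points with d > 1, at which |g'| is not
      controlled.\<close>
    have "AE x in circle. min 1 \<delta> \<le> jac g g' x"
      using B c d_pos circ
    proof eventually_elim
      case (elim x)
      show ?case
      proof (cases "jac g g' x \<le> 1")
        case True
        have "m\<^sup>2 * (norm (g' x))\<^sup>2 \<le> (norm (g x))\<^sup>2 * (norm (g' x))\<^sup>2"
          using m elim by (intro mult_right_mono power_mono) auto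
        also have "\<dots> = (g' x \<bullet> g x)\<^sup>2 + (jac g g' x)\<^sup>2"
          by (rule norm_product_eq_inner_jac)
        also have "\<dots> \<le> B\<^sup>2 + 1"
          using power_mono[of "\<bar>g' x \<bullet> g x\<bar>" B 2] power_mono[of "jac g g' x" 1 2] elim True by auto
        finally have "(norm (g' x))\<^sup>2 \<le> (B\<^sup>2 + 1) / m\<^sup>2"
          using m(1) by (simp add: field_simps)
        moreover have "0 \<le> (norm (g x))\<^sup>2" by simp
        ultimately have "c - 1/2 * ((B\<^sup>2 + 1) / m\<^sup>2) \<le> f_of h (jac g g' x)"
          using elim by linarith
        with elim have "\<delta> \<le> jac g g' x" by (intro \<delta>(2))
        then show ?thesis by simp
      qed simp
    qed
    with \<delta>(1) show ?thesis unfolding D_def by (intro exI[of _ "min 1 \<delta>"]) simp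
  qed

  have "ess_inf circle (jac g g') = 0 \<longleftrightarrow> \<not> D"
  proof -
    have "ereal 0 \<le> ess_inf circle (jac g g')"
      unfolding le_ess_inf_iff[OF d_meas] using d_pos by eventually_elim simp
    then have "0 \<le> ess_inf circle (jac g g')" by (simp add: zero_ereal_def)
    moreover have "0 < ess_inf circle (jac g g') \<longleftrightarrow> D"
    proof
      assume "0 < ess_inf circle (jac g g')"
      \<comment> \<open>The essential infimum is an extended real; a real number strictly between 0
        and it serves as the constant in \<open>D\<close>.\<close>
      then obtain \<delta> where "0 < ereal \<delta>" "ereal \<delta> < ess_inf circle (jac g g')"
        using ereal_dense2 by blast
      then show D
        unfolding D_def by (auto simp: less_imp_le simp flip: le_ess_inf_iff[OF d_meas])
    next
      assume D
      then obtain \<delta> where "0 < \<delta>" "ereal \<delta> \<le> ess_inf circle (jac g g')"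
        unfolding D_def le_ess_inf_iff[OF d_meas] by blast
      then show "0 < ess_inf circle (jac g g')"
        by (metis ereal_less(2) less_le_trans)
    qed
    ultimately show ?thesis by auto
  qed
  then show ?thesis
    using D_imp_lip lip_imp_D D_imp_nonzero nonzero_imp_D by metis
qed

end
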